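(* Let $K$ be a field and let $k=4m+2$ with $m$ a positive integer. Let $$\begin{aligned} f=&\sum_{\substack{1\le i,j\le 2m+1\\ i\text{ odd}}}x_i\,y_j\,z_{[i+j-1]_{2m+1}}\,w_{[\frac{i-1}{2}+j]_{2m+1}} +\sum_{\substack{1\le i,j\le 2m+1\\ i\text{ odd}}}\overline{x}_i\,y_j\,\overline{z}_{[i+j-1]_{2m+1}}\,\overline{w}_{[\frac{i-1}{2}+j+m]_{2m+1}}\\ &+\sum_{\substack{1\le i,j\le 2m+1\\ i\text{ odd}}}x_i\,\overline{y}_j\,\overline{z}_{[i+j-1]_{2m+1}}\,\overline{w}_{[\frac{i-1}{2}+j]_{2m+1}} +\sum_{\substack{1\le i,j\le 2m+1\\ i\text{ odd}}}\overline{x}_i\,\overline{y}_j\,z_{[i+j-1]_{2m+1}}\,w_{[\frac{i-1}{2}+j+m]_{2m+1}}\\ &+\sum_{\substack{1\le i,j\le 2m+1\\ i\text{ even}}}x_i\,y_j\,z_{[i+j-1]_{2m+1}}\,\overline{w}_{[\frac{i-2}{2}+j]_{2m+1}} +\sum_{\substack{1\le i,j\le 2m+1\\ i\text{ even}}}\overline{x}_i\,y_j\,\overline{z}_{[i+j-1]_{2m+1}}\,w_{[\frac{i}{2}+j+m]_{2m+1}}\\ &+\sum_{\substack{1\le i,j\le 2m+1\\ i\text{ even}}}x_i\,\overline{y}_j\,\overline{z}_{[i+j-1]_{2m+1}}\,w_{[\frac{i-2}{2}+j]_{2m+1}} +\sum_{\substack{1\le i,j\le 2m+1\\ i\text{ even}}}\overline{x}_i\,\overline{y}_j\,z_{[i+j-1]_{2m+1}}\,\overline{w}_{[\frac{i}{2}+j+m]_{2m+1}}\\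 &+\sum_{1\le j\le 2m+1}\overline{x}_{2m+1}\,y_j\,\overline{z}_j\,w_j +\sum_{1\le j\le 2m+1}\overline{x}_{2m+1}\,\overline{y}_j\,z_j\,\overline{w}_j, \end{aligned}$$ a polynomial in $K[x_1,\dots,x_k,y_1,\dots,y_k,z_1,\dots,z_k,w_1,\dots,w_k]$. Then $f$ is a balanced neighborly polynomial of type $(k,k,k,k)$.
   Context: For a positive integer $n$ and an integer $i$, $[i]_n\in\{1,2,\dots,n\}$ denotes the number with $[i]_n\equiv i\pmod n$. For even $k$ and $i=1,\dots,\frac{k}{2}$ put $\overline{x}_i=x_{i+\frac{k}{2}}$, $\overline{y}_i=y_{i+\frac{k}{2}}$, $\overline{z}_i=z_{i+\frac{k}{2}}$, $\overline{w}_i=w_{i+\frac{k}{2}}$. The ring $R=K[x_1,\dots,x_k,y_1,\dots,y_k,z_1,\dots,z_k,w_1,\dots,w_k]$ is $\mathbb{Z}^4$-graded by $\deg(x_i)=\mathfrak{e}_1=(1,0,0,0)$, $\deg(y_i)=\mathfrak{e}_2=(0,1,0,0)$, $\deg(z_i)=\mathfrak{e}_3=(0,0,1,0)$, $\deg(w_i)=\mathfrak{e}_4=(0,0,0,1)$. A polynomial $f\in R$ is balanced if it is homogeneous for this grading of degree $(1,1,1,1)$. For $S\subseteq\{1,2,3,4\}$ put $\mathfrak{e}_S=\sum_{i\in S}\mathfrak{e}_i$, let $R_{\mathfrak{e}_S}$ be the graded component of degree $\mathfrak{e}_S$, and for balanced $f$ set $H(f,S)=\dim_K\{g(\partial)f\mid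 g\in R_{\mathfrak{e}_S}\}$, where $g(\partial)$ is the differential operator obtained from $g$ by replacing each variable by the partial derivative with respect to that variable. A balanced polynomial $f\in R$ is a balanced neighborly polynomial of type $(k,k,k,k)$ if $H(f,S)=k^{|S|}$ for every $S\subseteq\{1,2,3,4\}$ with $|S|\le 2$. *)

theory Defs
  imports Complex_Main "HOL-Library.Poly_Mapping"
begin

datatype var = X nat | Y nat | Z nat | W nat

fun var_index :: "var \<Rightarrow> nat" where
  "var_index (X i) = i"
| "var_index (Y i) = i"
| "var_index (Z i) = i"
| "var_index (W i) = i"

(* A monomial is its exponent vector; a polynomial is the finitely supported family of its
   coefficients. *)
type_synonym 'a polynomial = "(var \<Rightarrow>\<^sub>0 nat) \<Rightarrow>\<^sub>0 'a"

definition var_poly :: "var \<Rightarrow> 'a::field polynomial" where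
  "var_poly v = Poly_Mapping.single (Poly_Mapping.single v 1) 1"

definition smult_poly :: "'a::field \<Rightarrow> 'a polynomial \<Rightarrow> 'a polynomial" where
  "smult_poly c p = Poly_Mapping.single 0 c * p"

global_interpretation poly_space: vector_space smult_poly
  by unfold_locales
     (simp_all add: smult_poly_def algebra_simps single_add mult_single flip: mult.assoc)

(* R = K[x_1..x_k, y_1..y_k, z_1..z_k, w_1..w_k], inside the ring on infinitely many variables. *)
definition ring_R :: "nat \<Rightarrow> 'a::field polynomial set" where
  "ring_R k = {p. \<forall>a\<in>Poly_Mapping.keys p. \<forall>v\<in>Poly_Mapping.keys a. var_index v \<in> {1..k}}"

(* Elements of the grading group Z^4 are functions on the positions 1, 2, 3, 4, extended by 0. *)
type_synonym multidegree = "nat \<Rightarrow> int"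

definition unit_deg :: "nat \<Rightarrow> multidegree" where
  "unit_deg i = (\<lambda>j. if j = i then 1 else 0)"

definition set_deg :: "nat set \<Rightarrow> multidegree" where
  "set_deg S = (\<lambda>j. \<Sum>i\<in>S. unit_deg i j)"

fun var_deg :: "var \<Rightarrow> multidegree" where
  "var_deg (X i) = unit_deg 1"
| "var_deg (Y i) = unit_deg 2"
| "var_deg (Z i) = unit_deg 3"
| "var_deg (W i) = unit_deg 4"

definition monom_deg :: "(var \<Rightarrow>\<^sub>0 nat) \<Rightarrow> multidegree" where
  "monom_deg a = (\<lambda>j. \<Sum>v\<in>Poly_Mapping.keys a. int (Poly_Mapping.lookup a v) * var_deg v j)"

definition graded_component :: "nat \<Rightarrow> multidegree \<Rightarrow> 'a::field polynomial set" where
  "graded_component k d = {p \<in> ring_R k. \<forall>a\<in>Poly_Mapping.keys p. monom_deg a = d}"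

definition balanced :: "nat \<Rightarrow> 'a::field polynomial \<Rightarrow> bool" where
  "balanced k f \<longleftrightarrow> f \<in> graded_component k (\<lambda>j. if j \<in> {1, 2, 3, 4} then 1 else 0)"

(* The exponent subtraction is truncated only where the coefficient is 0. *)
definition partial_deriv :: "var \<Rightarrow> 'a::field polynomial \<Rightarrow> 'a polynomial" where
  "partial_deriv v p = (\<Sum>a\<in>Poly_Mapping.keys p.
     Poly_Mapping.single (a - Poly_Mapping.single v 1)
       (of_nat (Poly_Mapping.lookup a v) * Poly_Mapping.lookup p a))"

lemma lookup_partial_deriv:
  "Poly_Mapping.lookup (partial_deriv v p) b =
     of_nat (Suc (Poly_Mapping.lookup b v)) *
       Poly_Mapping.lookup p (b + Poly_Mapping.single v 1)"
proof -
  let ?s = "Poly_Mapping.single v (1::nat)"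
  have eq: "a - ?s = b \<longleftrightarrow> a = b + ?s" if "Poly_Mapping.lookup a v \<noteq> 0" for a
  proof
    assume "a - ?s = b"
    moreover have "a = (a - ?s) + ?s"
      by (rule poly_mapping_eqI)
         (use that in \<open>auto simp: lookup_add lookup_minus lookup_single when_def\<close>)
    ultimately show "a = b + ?s" by simp
  qed simp
  have "Poly_Mapping.lookup (partial_deriv v p) b =
      (\<Sum>a\<in>Poly_Mapping.keys p. (of_nat (Poly_Mapping.lookup a v) * Poly_Mapping.lookup p a
         when a - ?s = b))"
    by (simp add: partial_deriv_def lookup_sum lookup_single)
  also have "\<dots> = (\<Sum>a\<in>Poly_Mapping.keys p. if b + ?s = a
      then of_nat (Poly_Mapping.lookup a v) * Poly_Mapping.lookup p a else 0)"
  proof (rule sum.cong)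
    fix a
    show "(of_nat (Poly_Mapping.lookup a v) * Poly_Mapping.lookup p a when a - ?s = b) =
        (if b + ?s = a then of_nat (Poly_Mapping.lookup a v) * Poly_Mapping.lookup p a else 0)"
      using eq[of a] by (cases "Poly_Mapping.lookup a v = 0") (auto simp: when_def)
  qed simp
  also have "\<dots> = of_nat (Suc (Poly_Mapping.lookup b v)) * Poly_Mapping.lookup p (b + ?s)"
    by (simp add: sum.delta' lookup_add in_keys_iff)
  finally show ?thesis .
qed

lemma partial_deriv_commute:
  "partial_deriv u (partial_deriv v p) = partial_deriv v (partial_deriv u p)"
  by (rule poly_mapping_eqI)
     (cases "u = v", auto simp: lookup_partial_deriv lookup_add lookup_single add_ac mult_ac)

(* Applying a monomial: the partial derivatives are composed in an arbitrary order, which is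
   harmless because they commute. *)
definition monom_diff :: "(var \<Rightarrow>\<^sub>0 nat) \<Rightarrow> 'a::field polynomial \<Rightarrow> 'a polynomial" where
  "monom_diff a f =
     Finite_Set.fold (\<lambda>v. partial_deriv v ^^ Poly_Mapping.lookup a v) f (Poly_Mapping.keys a)"

lemma comp_fun_commute_partial_deriv:
  "comp_fun_commute (\<lambda>v. (partial_deriv v :: 'a::field polynomial \<Rightarrow> _) ^^ n v)"
proof
  fix u v
  have 1: "partial_deriv u ((partial_deriv v ^^ l) p) = (partial_deriv v ^^ l) (partial_deriv u p)"
    for l and p :: "'a polynomial"
    by (induction l) (simp_all, metis partial_deriv_commute)
  have "(partial_deriv u ^^ j) ((partial_deriv v ^^ l) p) =
      (partial_deriv v ^^ l) ((partial_deriv u ^^ j) p)" for j l and p :: "'a polynomial"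
    by (induction j) (simp_all add: 1)
  then show "(partial_deriv u :: 'a polynomial \<Rightarrow> _) ^^ n u \<circ> partial_deriv v ^^ n v =
      partial_deriv v ^^ n v \<circ> partial_deriv u ^^ n u"
    by (simp add: fun_eq_iff)
qed

(* g(\<partial>) f *)
definition poly_diff :: "'a::field polynomial \<Rightarrow> 'a polynomial \<Rightarrow> 'a polynomial" where
  "poly_diff g f =
     (\<Sum>a\<in>Poly_Mapping.keys g. smult_poly (Poly_Mapping.lookup g a) (monom_diff a f))"

definition H :: "nat \<Rightarrow> 'a::field polynomial \<Rightarrow> nat set \<Rightarrow> nat" where
  "H k f S = poly_space.dim {poly_diff g f | g. g \<in> graded_component k (set_deg S)}"

(* Only the type (k,k,k,k). *)
definition balanced_neighborly :: "nat \<Rightarrow> 'a::field polynomial \<Rightarrow> bool" where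
  "balanced_neighborly k f \<longleftrightarrow>
     balanced k f \<and> (\<forall>S. S \<subseteq> {1, 2, 3, 4} \<and> card S \<le> 2 \<longrightarrow> H k f S = k ^ card S)"

(* The representative of i modulo n in {1, ..., n}. *)
definition cyc :: "nat \<Rightarrow> int \<Rightarrow> nat" where
  "cyc n i = nat ((i - 1) mod int n) + 1"

lemma cyc_unique:
  assumes "n > 0"
  shows "cyc n i = j \<longleftrightarrow> j \<in> {1..n} \<and> int j mod int n = i mod int n"
proof -
  have *: "cyc n i \<in> {1..n}" "int (cyc n i) mod int n = i mod int n"
    using assms by (auto simp: cyc_def nat_less_iff Suc_le_eq mod_add_left_eq add.commute)
      (metis add.commute diff_add_cancel mod_add_left_eq)
  have "j = cyc n i" if "j \<in> {1..n}" "int j mod int n = i mod int n"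
  proof -
    have "int n dvd int j - int (cyc n i)"
      using that * by (metis mod_eq_dvd_iff)
    moreover have "\<bar>int j - int (cyc n i)\<bar> < int n"
      using that * by auto
    ultimately show ?thesis
      by (metis abs_of_nat dvd_imp_le_int eq_iff_diff_eq_0 linorder_not_less of_nat_eq_iff)
  qed
  with * show ?thesis by auto
qed

definition odds :: "nat \<Rightarrow> nat set" where
  "odds n = {i \<in> {1..n}. odd i}"

definition evens :: "nat \<Rightarrow> nat set" where
  "evens n = {i \<in> {1..n}. even i}"

(* xb, yb, zb, wb are the overlined variables; every division by 2 of an index is exact. *)
definition nbly_poly :: "nat \<Rightarrow> 'a::field polynomial" where
  "nbly_poly m =
    (let k = 4 * m + 2;
         n = 2 * m + 1;
         c = cyc n;
         x = (\<lambda>i. var_poly (X i)); xb = (\<lambda>i. x (i + k div 2));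
         y = (\<lambda>i. var_poly (Y i)); yb = (\<lambda>i. y (i + k div 2));
         z = (\<lambda>i. var_poly (Z i)); zb = (\<lambda>i. z (i + k div 2));
         w = (\<lambda>i. var_poly (W i)); wb = (\<lambda>i. w (i + k div 2))
     in (\<Sum>i\<in>odds n. \<Sum>j\<in>{1..n}.
           x i * y j * z (c (int i + int j - 1)) * w (c ((int i - 1) div 2 + int j)))
      + (\<Sum>i\<in>odds n. \<Sum>j\<in>{1..n}.
           xb i * y j * zb (c (int i + int j - 1)) * wb (c ((int i - 1) div 2 + int j + int m)))
      + (\<Sum>i\<in>odds n. \<Sum>j\<in>{1..n}.
           x i * yb j * zb (c (int i + int j - 1)) * wb (c ((int i - 1) div 2 + int j)))
      + (\<Sum>i\<in>odds n. \<Sum>j\<in>{1..n}.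
           xb i * yb j * z (c (int i + int j - 1)) * w (c ((int i - 1) div 2 + int j + int m)))
      + (\<Sum>i\<in>evens n. \<Sum>j\<in>{1..n}.
           x i * y j * z (c (int i + int j - 1)) * wb (c ((int i - 2) div 2 + int j)))
      + (\<Sum>i\<in>evens n. \<Sum>j\<in>{1..n}.
           xb i * y j * zb (c (int i + int j - 1)) * w (c (int i div 2 + int j + int m)))
      + (\<Sum>i\<in>evens n. \<Sum>j\<in>{1..n}.
           x i * yb j * zb (c (int i + int j - 1)) * w (c ((int i - 2) div 2 + int j)))
      + (\<Sum>i\<in>evens n. \<Sum>j\<in>{1..n}.
           xb i * yb j * z (c (int i + int j - 1)) * wb (c (int i div 2 + int j + int m)))
      + (\<Sum>j\<in>{1..n}. xb n * y j * zb j * w j)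
      + (\<Sum>j\<in>{1..n}. xb n * yb j * z j * wb j))"

end

theory Submission
  imports Defs "HOL-Number_Theory.Cong"
begin

text \<open>After identifying each block of \<open>k = 2 n\<close> variables with \<open>\<int>/k\<close>, \<open>n = 2 m + 1\<close>, the
  polynomial is the sum of all \<open>x\<^sub>a y\<^sub>b z\<^sub>c w\<^sub>d\<close> with \<open>c = b + F a\<close> and \<open>d = b + G a\<close>, where \<open>F\<close>
  and \<open>G\<close> are bijections and \<open>F - G\<close> is a bijection up to one repeated value (attained at the last
  index \<open>a = k\<close>) and one omitted value, plus extra terms at \<open>a = k\<close> that realise the omitted value.
  Hence for each of the three splittings of the four blocks into two pairs the coefficient matrix
  is a permutation matrix with additional entries in the rows \<open>a = k\<close> only, each in a column
  matched to a row with \<open>a \<noteq> k\<close>. Such a matrix is unitriangular in a suitable order, so it is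
  invertible over every field; smaller degrees follow by restriction.\<close>

section \<open>Matrices that are a permutation plus a few extra entries\<close>

definition rows_independent :: "'i set \<Rightarrow> 'j set \<Rightarrow> ('i \<Rightarrow> 'j \<Rightarrow> 'a::field) \<Rightarrow> bool" where
  "rows_independent A B M \<longleftrightarrow>
     (\<forall>u. (\<forall>b\<in>B. (\<Sum>a\<in>A. u a * M a b) = 0) \<longrightarrow> (\<forall>a\<in>A. u a = 0))"

lemma rows_independentI:
  assumes "\<And>u a. (\<And>b. b \<in> B \<Longrightarrow> (\<Sum>a\<in>A. u a * M a b) = 0) \<Longrightarrow> a \<in> A \<Longrightarrow> u a = 0"
  shows "rows_independent A B M"
  using assms unfolding rows_independent_def by blast

lemma rows_independentD:
  assumes "rows_independent A B M" "\<And>b. b \<in> B \<Longrightarrow> (\<Sum>a\<in>A. u a * M a b) = 0" "a \<in> A"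
  shows "u a = 0"
  using assms unfolding rows_independent_def by blast

text \<open>Identifying columns with rows through \<open>\<pi>\<close> turns \<open>M\<close> into
  \<open>I + N\<close>, where \<open>N\<close> has entries only in rows in \<open>T\<close> and
  columns outside \<open>T\<close>. Hence \<open>N\<close> squared is 0 and \<open>M\<close> is
  invertible over every field. The transpose is recorded too, because it serves the complementary
  pair of blocks.\<close>

lemma unitriangular_independent:
  fixes M :: "'i \<Rightarrow> 'j \<Rightarrow> 'a::field"
  assumes fin: "finite A" and bij: "bij_betw \<pi> A B"
    and s: "\<And>r. r \<in> T \<Longrightarrow> s r \<in> A - T"
    and M: "\<And>r c. r \<in> A \<Longrightarrow> c \<in> B \<Longrightarrow> M r c = of_bool (c = \<pi> r) + of_bool (r \<in> T \<and> c = \<pi> (s r))"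
  shows "rows_independent A B M" and "rows_independent B A (\<lambda>c r. M r c)"
proof -
  have inj: "\<pi> r = \<pi> r' \<longleftrightarrow> r = r'" if "r \<in> A" "r' \<in> A" for r r'
    using bij that by (auto simp: bij_betw_def inj_on_def)
  have B: "\<pi> r \<in> B" if "r \<in> A" for r
    using bij that by (auto simp: bij_betw_def)
  have finB: "finite B" using fin bij bij_betw_finite by blast
  show "rows_independent A B M"
  proof (rule rows_independentI)
    fix u r0 assume u: "\<And>b. b \<in> B \<Longrightarrow> (\<Sum>a\<in>A. u a * M a b) = 0" and r0: "r0 \<in> A"
    have *: "(\<Sum>r\<in>A. u r * M r (\<pi> r0)) = u r0 + (\<Sum>r\<in>A. u r * of_bool (r \<in> T \<and> r0 = s r))"
      if "r0 \<in> A" for r0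
    proof -
      have "(\<Sum>r\<in>A. u r * M r (\<pi> r0)) =
          (\<Sum>r\<in>A. (if r = r0 then u r else 0) + u r * of_bool (r \<in> T \<and> r0 = s r))"
        by (rule sum.cong) (use that s in \<open>auto simp: M B inj algebra_simps\<close>)
      then show ?thesis using that fin by (simp add: sum.distrib)
    qed
    \<comment> \<open>Since \<open>s\<close> avoids \<open>T\<close>, a column matched to a row in
      \<open>T\<close> has no additional entry, so its equation isolates \<open>u r\<close>.\<close>
    have T: "u r = 0" if "r \<in> A" "r \<in> T" for r
    proof -
      have "(\<Sum>r'\<in>A. u r' * of_bool (r' \<in> T \<and> r = s r')) = 0"
        by (rule sum.neutral) (use s that in auto)
      with *[OF that(1)] u[OF B[OF that(1)]] show ?thesis by simp
    qed
    have "(\<Sum>r'\<in>A. u r' * of_bool (r' \<in> T \<and> r0 = s r')) = 0"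
      by (rule sum.neutral) (use T in auto)
    with *[OF r0] u[OF B[OF r0]] show "u r0 = 0" by simp
  qed
  show "rows_independent B A (\<lambda>c r. M r c)"
  proof (rule rows_independentI)
    fix u c assume u: "\<And>r. r \<in> A \<Longrightarrow> (\<Sum>c\<in>B. u c * M r c) = 0" and c: "c \<in> B"
    have *: "u (\<pi> r) + (if r \<in> T then u (\<pi> (s r)) else 0) = 0" if "r \<in> A" for r
    proof -
      have "(\<Sum>c\<in>B. u c * M r c) = (\<Sum>c\<in>B. (if c = \<pi> r then u c else 0) +
          (if r \<in> T then (if c = \<pi> (s r) then u c else 0) else 0))"
        by (rule sum.cong) (use that in \<open>auto simp: M algebra_simps\<close>)
      also have "\<dots> = u (\<pi> r) + (if r \<in> T then u (\<pi> (s r)) else 0)"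
        using finB B s that by (auto simp: sum.distrib)
      finally show ?thesis using u[OF that] by simp
    qed
    obtain r where r: "r \<in> A" "c = \<pi> r" using c bij by (auto simp: bij_betw_def)
    \<comment> \<open>If \<open>r\<close> is in \<open>T\<close>, the row \<open>s r\<close> lies
      outside \<open>T\<close> and has a single entry, which gives
      \<open>u (\<pi> (s r)) = 0\<close>; the row \<open>r\<close> then gives the claim.\<close>
    show "u c = 0"
      using *[OF r(1)] *[of "s r"] s[of r] r(2) by (auto split: if_splits)
  qed
qed

section \<open>Indices as residues modulo \<open>4 m + 2\<close>\<close>

text \<open>The Chinese remainder theorem identifies the index \<open>i\<close> (or the overlined index \<open>i\<close>) with
  the class modulo \<open>2 (2 m + 1)\<close> that is \<open>i - 1\<close> modulo \<open>2 m + 1\<close> and even (or odd).\<close>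

definition code :: "nat \<Rightarrow> nat \<Rightarrow> int" where
  "code m a = (int a - 1) * (2 * int m + 2) + (if a > 2 * m + 1 then 2 * int m + 1 else 0)"

definition decode :: "nat \<Rightarrow> int \<Rightarrow> nat" where
  "decode m u = nat (u mod (2 * int m + 1)) + 1 + (if odd u then 2 * m + 1 else 0)"

text \<open>The numbers \<open>2 * m + 2\<close> and \<open>2 * m + 1\<close> are the idempotents of
  the Chinese remainder theorem. The class is thus the quotient of \<open>a - 1\<close> by 2 modulo
  \<open>2 * m + 1\<close>, and its parity is the remainder.\<close>

definition wshift :: "nat \<Rightarrow> nat \<Rightarrow> int" where
  "wshift m a = (int a - 1) div 2 * (2 * int m + 2) + (int a - 1) mod 2 * (2 * int m + 1)"

lemma cong_iff_parity:
  "[u = v] (mod (4 * int m + 2)) \<longleftrightarrow> [u = v] (mod (2 * int m + 1)) \<and> (odd u \<longleftrightarrow> odd v)"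
proof -
  have "coprime (2 * int m + 1) 2" by simp
  then have "(2 * int m + 1) * 2 dvd u - v \<longleftrightarrow> 2 * int m + 1 dvd u - v \<and> 2 dvd u - v"
    by (meson divides_mult dvd_mult_left dvd_mult_right)
  then show ?thesis by (auto simp: cong_iff_dvd_diff algebra_simps)
qed

lemma even_code: "even (code m a) \<longleftrightarrow> a \<le> 2 * m + 1"
  by (simp add: code_def)

lemma cong_code: "[code m a = int a - 1] (mod (2 * int m + 1))"
proof -
  have "code m a - (int a - 1) = (2 * int m + 1) * (int a - 1 + of_bool (a > 2 * m + 1))"
    by (simp add: code_def algebra_simps)
  then show ?thesis by (simp add: cong_iff_dvd_diff)
qed

lemma even_wshift: "even (wshift m a) \<longleftrightarrow> odd a"
  by (auto simp: wshift_def)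

lemma cong_wshift: "[wshift m a = (int a - 1) div 2] (mod (2 * int m + 1))"
proof -
  have "wshift m a - (int a - 1) div 2 =
      (2 * int m + 1) * ((int a - 1) div 2 + (int a - 1) mod 2)"
    by (simp add: wshift_def algebra_simps)
  then show ?thesis by (simp add: cong_iff_dvd_diff)
qed

lemma decode_mem: "decode m u \<in> {1..4 * m + 2}"
proof -
  have "u mod (2 * int m + 1) < 2 * int m + 1" by (rule pos_mod_bound) simp
  then show ?thesis by (auto simp: decode_def)
qed

lemma decode_eq_iff: "decode m u = decode m v \<longleftrightarrow> [u = v] (mod (4 * int m + 2))"
proof -
  have "u mod (2 * int m + 1) < 2 * int m + 1" "v mod (2 * int m + 1) < 2 * int m + 1"
    "u mod (2 * int m + 1) \<ge> 0" "v mod (2 * int m + 1) \<ge> 0"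
    using pos_mod_bound[of "2 * int m + 1" u] pos_mod_bound[of "2 * int m + 1" v] by auto
  then show ?thesis unfolding cong_iff_parity unfolding cong_def
    by (auto simp: decode_def eq_nat_nat_iff)
qed

lemma decode_code:
  assumes "a \<in> {1..4 * m + 2}"
  shows "decode m (code m a) = a"
proof -
  have "code m a mod (2 * int m + 1) = (int a - 1) mod (2 * int m + 1)"
    using cong_code by (simp add: cong_def)
  also have "\<dots> = int a - 1 - (if a > 2 * m + 1 then 2 * int m + 1 else 0)"
  proof (cases "a > 2 * m + 1")
    case True
    then have "(int a - 1) mod (2 * int m + 1) = (int a - 1 - (2 * int m + 1)) mod (2 * int m + 1)"
      by (metis minus_mod_self2)
    with True assms show ?thesis by (simp add: mod_pos_pos_trivial)
  qed (use assms in \<open>simp add: mod_pos_pos_trivial\<close>)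
  finally show ?thesis using assms by (auto simp: decode_def even_code nat_diff_distrib)
qed

text \<open>This turns equations between indices into congruences, which can be solved for any of
  the indices involved.\<close>

lemma eq_decode_iff:
  assumes "a \<in> {1..4 * m + 2}"
  shows "a = decode m u \<longleftrightarrow> [code m a = u] (mod (4 * int m + 2))"
  using decode_eq_iff decode_code[OF assms] by metis

lemma inj_code:
  assumes "a \<in> {1..4 * m + 2}" "b \<in> {1..4 * m + 2}" "[code m a = code m b] (mod (4 * int m + 2))"
  shows "a = b"
  using assms decode_code decode_eq_iff by metis

lemma cong_small_imp_eq:
  fixes x y :: int
  assumes "[x = y] (mod n)" "x \<in> {0..<n}" "y \<in> {0..<n}"
  shows "x = y"
  using assms by (simp add: cong_def mod_pos_pos_trivial)

text \<open>The quotient \<open>(a - 1) div 2\<close> is at most \<open>2 * m\<close>, so its class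
  modulo \<open>2 * m + 1\<close> determines it; the parity supplies the remainder.\<close>

lemma inj_wshift:
  assumes a: "a \<in> {1..4 * m + 2}" and b: "b \<in> {1..4 * m + 2}"
    and "[wshift m a = wshift m b] (mod (4 * int m + 2))"
  shows "a = b"
proof -
  have "[wshift m a = wshift m b] (mod (2 * int m + 1))" and p: "even a \<longleftrightarrow> even b"
    using assms(3) by (auto simp: cong_iff_parity even_wshift)
  then have "[(int a - 1) div 2 = (int b - 1) div 2] (mod (2 * int m + 1))"
    by (meson cong_wshift cong_trans cong_sym)
  then have "(int a - 1) div 2 = (int b - 1) div 2"
    by (rule cong_small_imp_eq) (use a b in auto)
  with p a b show ?thesis by simp presburger
qed

text \<open>The difference \<open>code - wshift\<close> takes the value 0 at both 1 and \<open>4 m + 2\<close> and misses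
  \<open>2 m + 1\<close>; the additional terms of the polynomial supply this missing value.\<close>

lemma inj_code_minus_wshift:
  defines "d m a \<equiv> (if a = 4 * m + 2 then 2 * int m + 1 else code m a - wshift m a)"
  assumes a: "a \<in> {1..4 * m + 2}" and b: "b \<in> {1..4 * m + 2}"
    and eq: "[d m a = d m b] (mod (4 * int m + 2))"
  shows "a = b"
proof -
  \<comment> \<open>On the index range, \<open>h\<close> is the representative of \<open>d\<close>
    in \<open>{0..<2 * m + 1}\<close>. The quotient arises as \<open>a - 1 - (a - 1) div 2\<close>;
    the last index gets 0, the class of \<open>2 * m + 1\<close>.\<close>
  define h where "h a = (if a = 4 * m + 2 then 0 else int a div 2)" for a
  have h: "[d m a = h a] (mod (2 * int m + 1))" for a
  proof (cases "a = 4 * m + 2")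
    case False
    have "[code m a - wshift m a = int a - 1 - (int a - 1) div 2] (mod (2 * int m + 1))"
      by (intro cong_diff cong_code cong_wshift)
    moreover have "int a - 1 - (int a - 1) div 2 = int a div 2" by presburger
    ultimately show ?thesis using False by (simp add: d_def h_def)
  qed (simp add: d_def h_def cong_def)
  have "[h a = h b] (mod (2 * int m + 1))"
    using eq h[of a] h[of b] unfolding cong_iff_parity by (meson cong_trans cong_sym)
  then have 1: "h a = h b"
    by (rule cong_small_imp_eq) (use a b in \<open>auto simp: h_def\<close>)
  have odd_d: "odd (d m a) \<longleftrightarrow> a = 4 * m + 2 \<or> (a > 2 * m + 1 \<longleftrightarrow> odd a)" for a
    by (auto simp: d_def even_code even_wshift)
  have 2: "odd (d m a) \<longleftrightarrow> odd (d m b)"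
    using eq unfolding cong_iff_parity by blast
  have bot: "x = 1" if "h x = 0" "x \<in> {1..4 * m + 2}" "x \<noteq> 4 * m + 2" for x
    using that unfolding h_def by simp presburger
  \<comment> \<open>Within the range \<open>h\<close> vanishes only at 1 and
    \<open>4 * m + 2\<close>. Parity separates these two, since the last index carries
    \<open>2 * m + 1\<close> instead of \<open>code - wshift\<close>.\<close>
  have top: "h (4 * m + 2) = 0" "odd (d m (4 * m + 2))" by (simp_all add: h_def d_def)
  have even1: "even (d m 1)" using odd_d[of 1] by simp
  consider "a = 4 * m + 2" "b = 4 * m + 2" | "a = 4 * m + 2" "b \<noteq> 4 * m + 2"
    | "a \<noteq> 4 * m + 2" "b = 4 * m + 2" | "a \<noteq> 4 * m + 2" "b \<noteq> 4 * m + 2" by blast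
  then show ?thesis
  proof cases
    case 2
    then have "b = 1" using \<open>h a = h b\<close> top bot[of b] b by simp
    then show ?thesis using 2 even1 top \<open>odd (d m a) \<longleftrightarrow> odd (d m b)\<close> by simp
  next
    case 3
    then have "a = 1" using \<open>h a = h b\<close> top bot[of a] a by simp
    then show ?thesis using 3 even1 top \<open>odd (d m a) \<longleftrightarrow> odd (d m b)\<close> by simp
  next
    case 4
    then have "int (a div 2) = int (b div 2)"
      using \<open>h a = h b\<close> unfolding h_def zdiv_int by simp
    then have "a div 2 = b div 2" by linarith
    \<comment> \<open>Apart from equality only a pair \<open>y\<close>, \<open>Suc y\<close> with
      \<open>y\<close> even remains. Equal parities of \<open>d\<close> would force the threshold
      \<open>2 * m + 1\<close> to be \<open>y\<close> itself, but it is odd.\<close>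
    then have "a = b \<or> a = Suc b \<and> even b \<or> b = Suc a \<and> even a" by presburger
    then consider "a = b" | "a = Suc b" "even b" | "b = Suc a" "even a" by blast
    moreover have False if "even y" "(Suc y > 2 * m + 1 \<longleftrightarrow> odd (Suc y)) \<longleftrightarrow> (y > 2 * m + 1 \<longleftrightarrow> odd y)" for y
      using that by (cases "y = 2 * m + 1") auto
    moreover have "(a > 2 * m + 1 \<longleftrightarrow> odd a) \<longleftrightarrow> (b > 2 * m + 1 \<longleftrightarrow> odd b)"
      using 4 \<open>odd (d m a) \<longleftrightarrow> odd (d m b)\<close> unfolding odd_d by blast
    ultimately show ?thesis by cases blast+
  qed simp
qed

text \<open>The difference of the two column coordinates determines \<open>a\<close> through
  \<open>U a - V a\<close>, and then \<open>y\<close> follows; this gives the permutation. An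
  additional entry has difference \<open>U' - V'\<close>, so it sits in a column matched to a row
  with first index \<open>a0\<close>, which is not the last index.\<close>

lemma translation_matrix_independent:
  fixes M :: "nat \<times> nat \<Rightarrow> nat \<times> nat \<Rightarrow> 'a::field"
  assumes inj: "\<And>a b. a \<in> {1..4 * m + 2} \<Longrightarrow> b \<in> {1..4 * m + 2} \<Longrightarrow>
      [U a - V a = U b - V b] (mod (4 * int m + 2)) \<Longrightarrow> a = b"
    and a0: "a0 \<in> {1..<4 * m + 2}" "[U' - V' = U a0 - V a0] (mod (4 * int m + 2))"
    and M: "\<And>a y p q. a \<in> {1..4 * m + 2} \<Longrightarrow> y \<in> {1..4 * m + 2} \<Longrightarrow>
      p \<in> {1..4 * m + 2} \<Longrightarrow> q \<in> {1..4 * m + 2} \<Longrightarrow> M (a, y) (p, q) =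
        of_bool (p = decode m (code m y + U a) \<and> q = decode m (code m y + V a)) +
        of_bool (a = 4 * m + 2 \<and> p = decode m (code m y + U') \<and> q = decode m (code m y + V'))"
  shows "rows_independent ({1..4 * m + 2} \<times> {1..4 * m + 2}) ({1..4 * m + 2} \<times> {1..4 * m + 2}) M"
    and "rows_independent ({1..4 * m + 2} \<times> {1..4 * m + 2}) ({1..4 * m + 2} \<times> {1..4 * m + 2})
      (\<lambda>c r. M r c)"
proof -
  let ?I = "{1..4 * m + 2}"
  define \<pi> where "\<pi> = (\<lambda>(a, y). (decode m (code m y + U a), decode m (code m y + V a)))"
  \<comment> \<open>The second component solves \<open>y' + U a0 = y + U'\<close> modulo
    \<open>4 * m + 2\<close>; the corresponding equation for \<open>V\<close> then follows from the
    choice of \<open>a0\<close>.\<close>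
  define s where "s = (\<lambda>(a::nat, y). (a0, decode m (code m y + U' - U a0)))"
  have inj\<pi>: "inj_on \<pi> (?I \<times> ?I)"
  proof (rule inj_onI, clarify)
    fix a y b z
    assume I: "a \<in> ?I" "y \<in> ?I" "b \<in> ?I" "z \<in> ?I" and "\<pi> (a, y) = \<pi> (b, z)"
    then have 1: "[code m y + U a = code m z + U b] (mod (4 * int m + 2))"
      and 2: "[code m y + V a = code m z + V b] (mod (4 * int m + 2))"
      by (simp_all add: \<pi>_def decode_eq_iff)
    from cong_diff[OF 1 2] have "a = b" using inj I by (simp add: algebra_simps)
    moreover from this 1 have "y = z" using inj_code I by (simp add: cong_add_rcancel)
    ultimately show "a = b \<and> y = z" by blast
  qed
  have "\<pi> ` (?I \<times> ?I) \<subseteq> ?I \<times> ?I" using decode_mem by (auto simp: \<pi>_def simp del: atLeastAtMost_iff)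
  with inj\<pi> have bij: "bij_betw \<pi> (?I \<times> ?I) (?I \<times> ?I)"
    by (simp add: bij_betw_def endo_inj_surj)
  have s: "s r \<in> ?I \<times> ?I - {4 * m + 2} \<times> ?I" if "r \<in> {4 * m + 2} \<times> ?I" for r
    using a0 that decode_mem by (auto simp: s_def simp del: atLeastAtMost_iff) simp
  have \<pi>s: "\<pi> (s (a, y)) = (decode m (code m y + U'), decode m (code m y + V'))" for a y
  proof -
    let ?y = "decode m (code m y + U' - U a0)"
    have 1: "[code m ?y = code m y + U' - U a0] (mod (4 * int m + 2))"
      using eq_decode_iff[OF decode_mem] by blast
    have "[code m ?y + V a0 = code m y + U' - U a0 + V a0] (mod (4 * int m + 2))"
      using 1 by (simp add: cong_add_rcancel)
    moreover have "[code m y + U' - U a0 + V a0 = code m y + V'] (mod (4 * int m + 2))"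
      using a0(2) by (simp add: cong_iff_dvd_diff algebra_simps)
    moreover have "[code m ?y + U a0 = code m y + U' - U a0 + U a0] (mod (4 * int m + 2))"
      using 1 by (simp only: cong_add_rcancel)
    ultimately show ?thesis
      by (auto simp: \<pi>_def s_def decode_eq_iff intro: cong_trans)
  qed
  have M': "M r c = of_bool (c = \<pi> r) + of_bool (r \<in> {4 * m + 2} \<times> ?I \<and> c = \<pi> (s r))"
    if "r \<in> ?I \<times> ?I" "c \<in> ?I \<times> ?I" for r c
  proof -
    obtain a y p q where [simp]: "r = (a, y)" "c = (p, q)" by fastforce
    show ?thesis using that M[of a y p q] \<pi>s[of a y] by (auto simp: \<pi>_def)
  qed
  show "rows_independent (?I \<times> ?I) (?I \<times> ?I) M"
    and "rows_independent (?I \<times> ?I) (?I \<times> ?I) (\<lambda>c r. M r c)"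
    using unitriangular_independent[OF _ bij s M'] by auto
qed

section \<open>Monomials of squarefree degree\<close>

abbreviation var_monom :: "var \<Rightarrow> (var \<Rightarrow>\<^sub>0 nat)" where
  "var_monom v \<equiv> Poly_Mapping.single v 1"

text \<open>The last branch represents position 4 but catches every other number as well.\<close>

definition var_of :: "nat \<Rightarrow> nat \<Rightarrow> var" where
  "var_of p = (if p = 1 then X else if p = 2 then Y else if p = 3 then Z else W)"

text \<open>This is the monomial basis of \<open>graded_component k (set_deg S)\<close>.\<close>

definition monoms :: "nat \<Rightarrow> nat set \<Rightarrow> (var \<Rightarrow>\<^sub>0 nat) set" where
  "monoms k S = {a. (\<forall>v\<in>Poly_Mapping.keys a. var_index v \<in> {1..k}) \<and> monom_deg a = set_deg S}"

lemma var_index_var_of [simp]: "var_index (var_of p i) = i"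
  by (simp add: var_of_def)

lemma var_deg_var_of: "p \<in> {1, 2, 3, 4} \<Longrightarrow> var_deg (var_of p i) = unit_deg p"
  by (auto simp: var_of_def)

lemma var_of_eq_iff: "p \<in> {1, 2, 3, 4} \<Longrightarrow> var_of p i = var_of p j \<longleftrightarrow> i = j"
  by (auto simp: var_of_def)

lemma unit_deg_eq: "unit_deg p q = of_bool (p = q)"
  by (auto simp: unit_deg_def)

lemma var_deg_nonneg: "var_deg v q \<ge> 0"
  by (cases v) (simp_all add: unit_deg_eq)

lemma var_deg_pos: "\<exists>q\<in>{1, 2, 3, 4}. var_deg v q > 0"
  by (cases v) (simp_all add: unit_deg_eq)

lemma var_deg_posD: "var_deg v p > 0 \<Longrightarrow> v = var_of p (var_index v)"
  by (cases v) (auto simp: unit_deg_eq var_of_def split: if_splits)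

lemma monom_deg_superset:
  assumes "finite V" "Poly_Mapping.keys a \<subseteq> V"
  shows "monom_deg a q = (\<Sum>v\<in>V. int (Poly_Mapping.lookup a v) * var_deg v q)"
  unfolding monom_deg_def using assms
  by (intro sum.mono_neutral_left) (auto simp: in_keys_iff)

lemma monom_deg_add: "monom_deg (a + b) q = monom_deg a q + monom_deg b q"
proof -
  let ?V = "Poly_Mapping.keys a \<union> Poly_Mapping.keys b"
  have "monom_deg (a + b) q = (\<Sum>v\<in>?V. int (Poly_Mapping.lookup (a + b) v) * var_deg v q)"
    by (rule monom_deg_superset) (use keys_add[of a b] in auto)
  moreover have "monom_deg a q = (\<Sum>v\<in>?V. int (Poly_Mapping.lookup a v) * var_deg v q)"
    and "monom_deg b q = (\<Sum>v\<in>?V. int (Poly_Mapping.lookup b v) * var_deg v q)"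
    by (rule monom_deg_superset; auto)+
  ultimately show ?thesis by (simp add: lookup_add sum.distrib algebra_simps)
qed

lemma monom_deg_single [simp]: "monom_deg (Poly_Mapping.single v (Suc 0)) = var_deg v"
  by (simp add: monom_deg_def)

text \<open>All summands of a degree are nonnegative, so nothing cancels.\<close>

lemma monom_deg_pos: "monom_deg a q > 0 \<longleftrightarrow> (\<exists>v\<in>Poly_Mapping.keys a. var_deg v q > 0)"
proof -
  let ?t = "\<lambda>v. int (Poly_Mapping.lookup a v) * var_deg v q"
  have nonneg: "?t v \<ge> 0" for v by (simp add: var_deg_nonneg)
  have "monom_deg a q \<ge> 0" unfolding monom_deg_def by (rule sum_nonneg) (rule nonneg)
  moreover have "monom_deg a q = 0 \<longleftrightarrow> (\<forall>v\<in>Poly_Mapping.keys a. ?t v = 0)"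
    unfolding monom_deg_def by (rule sum_nonneg_eq_0_iff) (simp_all only: finite_keys nonneg)
  moreover have "?t v = 0 \<longleftrightarrow> \<not> var_deg v q > 0" if "v \<in> Poly_Mapping.keys a" for v
    using that var_deg_nonneg[of v q] by (auto simp: in_keys_iff)
  ultimately show ?thesis by (metis order_le_less order_less_irrefl)
qed

lemma set_deg_eq: "finite S \<Longrightarrow> set_deg S q = of_bool (q \<in> S)"
  by (simp add: set_deg_def unit_deg_def)

lemma monoms_empty: "monoms k {} = {0}"
proof -
  have "a = 0" if "a \<in> monoms k {}" for a
  proof (rule ccontr)
    assume "a \<noteq> 0"
    then obtain v where "v \<in> Poly_Mapping.keys a" by (metis keys_eq_empty ex_in_conv)
    then obtain q where "monom_deg a q > 0" using var_deg_pos monom_deg_pos by blast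
    with that show False by (simp add: monoms_def set_deg_eq)
  qed
  moreover have "0 \<in> monoms k {}" by (simp add: monoms_def monom_deg_def set_deg_def)
  ultimately show ?thesis by blast
qed

lemma monoms_add:
  assumes "a \<in> monoms k S" "b \<in> monoms k T" "finite S" "finite T" "S \<inter> T = {}"
  shows "a + b \<in> monoms k (S \<union> T)"
proof -
  have "monom_deg (a + b) = set_deg (S \<union> T)"
    using assms by (auto simp: fun_eq_iff monom_deg_add monoms_def set_deg_eq)
  then show ?thesis using assms keys_add[of a b] by (auto simp: monoms_def)
qed

text \<open>Degree 1 in position \<open>p\<close> means exactly one variable from that block, with
  exponent 1. Splitting it off is unambiguous because a monomial of degree \<open>set_deg S\<close>
  contains no variable of position \<open>p\<close>. Iterating this counts and enumerates all
  squarefree degrees.\<close>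

lemma bij_betw_monoms_insert:
  assumes p: "p \<in> {1, 2, 3, 4}" and S: "finite S" "p \<notin> S"
  shows "bij_betw (\<lambda>(i, a). var_monom (var_of p i) + a) ({1..k} \<times> monoms k S) (monoms k (insert p S))"
proof (rule bij_betwI')
  have no: "Poly_Mapping.lookup a (var_of p i) = 0" if "a \<in> monoms k S" for a i
  proof (rule ccontr)
    assume "Poly_Mapping.lookup a (var_of p i) \<noteq> 0"
    then have "monom_deg a p > 0"
      using p unfolding monom_deg_pos
      by (intro bexI[of _ "var_of p i"]) (auto simp: in_keys_iff var_deg_var_of unit_deg_eq)
    with that S show False by (simp add: monoms_def set_deg_eq)
  qed
  fix u v assume u: "u \<in> {1..k} \<times> monoms k S" and v: "v \<in> {1..k} \<times> monoms k S"
  obtain i a j b where [simp]: "u = (i, a)" "v = (j, b)" by fastforce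
  show "((case u of (i, a) \<Rightarrow> var_monom (var_of p i) + a) =
      (case v of (i, a) \<Rightarrow> var_monom (var_of p i) + a)) = (u = v)"
  proof
    assume eq: "(case u of (i, a) \<Rightarrow> var_monom (var_of p i) + a) =
      (case v of (i, a) \<Rightarrow> var_monom (var_of p i) + a)"
    then have "Poly_Mapping.lookup (var_monom (var_of p i) + a) (var_of p i) =
        Poly_Mapping.lookup (var_monom (var_of p j) + b) (var_of p i)" by simp
    then have "i = j"
      using u v no[of a i] no[of b i] p
      by (auto simp: lookup_add lookup_single when_def var_of_eq_iff split: if_splits)
    with eq show "u = v" by simp
  qed simp
next
  fix u assume "u \<in> {1..k} \<times> monoms k S"
  then obtain i a where [simp]: "u = (i, a)" and i: "i \<in> {1..k}" and a: "a \<in> monoms k S" by auto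
  have "var_monom (var_of p i) \<in> monoms k {p}"
    using i p by (simp add: monoms_def var_deg_var_of set_deg_def)
  from monoms_add[OF this a] S
  show "(case u of (i, a) \<Rightarrow> var_monom (var_of p i) + a) \<in> monoms k (insert p S)" by simp
next
  fix a assume a: "a \<in> monoms k (insert p S)"
  then have "monom_deg a p > 0" using S by (simp add: monoms_def set_deg_eq)
  then obtain v where v: "v \<in> Poly_Mapping.keys a" "var_deg v p > 0"
    using monom_deg_pos by blast
  define i where "i = var_index v"
  have vi: "v = var_of p i" using var_deg_posD[OF v(2)] by (simp add: i_def)
  define b where "b = a - var_monom v"
  have ab: "a = var_monom v + b"
    by (rule poly_mapping_eqI)
       (use v(1) in \<open>auto simp: b_def lookup_add lookup_minus lookup_single when_def in_keys_iff\<close>)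
  have "i \<in> {1..k}" using a v(1) by (auto simp: monoms_def i_def)
  moreover have "b \<in> monoms k S"
  proof -
    have "Poly_Mapping.keys b \<subseteq> Poly_Mapping.keys a"
      by (auto simp: b_def in_keys_iff lookup_minus)
    moreover have "monom_deg b q = set_deg S q" for q
    proof -
      have "monom_deg a q = unit_deg p q + monom_deg b q"
        using p by (simp add: ab monom_deg_add vi var_deg_var_of)
      moreover have "set_deg (insert p S) q = unit_deg p q + set_deg S q"
        using S by (auto simp: set_deg_eq unit_deg_eq)
      ultimately show ?thesis using a by (simp add: monoms_def)
    qed
    ultimately show ?thesis using a by (auto simp: monoms_def fun_eq_iff)
  qed
  ultimately show "\<exists>u\<in>{1..k} \<times> monoms k S. a = (case u of (i, a) \<Rightarrow> var_monom (var_of p i) + a)"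
    using ab vi by (intro bexI[of _ "(i, b)"]) auto
qed

lemma finite_card_monoms:
  assumes "S \<subseteq> {1, 2, 3, 4}"
  shows "finite (monoms k S) \<and> card (monoms k S) = k ^ card S"
proof -
  have "finite S" using assms finite_subset by blast
  then show ?thesis using assms
  proof induction
    case empty
    then show ?case by (simp add: monoms_empty)
  next
    case (insert p S)
    from insert.prems have p: "p \<in> {1, 2, 3, 4}" by blast
    note bij = bij_betw_monoms_insert[OF p insert.hyps, of k]
    from bij_betw_finite[OF bij] bij_betw_same_card[OF bij] insert
    show ?case by (simp add: card_cartesian_product)
  qed
qed

lemmas finite_monoms = finite_card_monoms[THEN conjunct1]
lemmas card_monoms = finite_card_monoms[THEN conjunct2]

lemma sum_monoms_pair:
  assumes "p \<in> {1, 2, 3, 4}" "q \<in> {1, 2, 3, 4}" "p \<noteq> q"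
  shows "(\<Sum>a\<in>monoms k {p, q}. h a) =
    (\<Sum>(i, j)\<in>{1..k} \<times> {1..k}. h (var_monom (var_of p i) + var_monom (var_of q j)))"
proof -
  have 1: "(\<Sum>a\<in>monoms k (insert r S). h a) =
      (\<Sum>i\<in>{1..k}. \<Sum>a\<in>monoms k S. h (var_monom (var_of r i) + a))"
    if "r \<in> {1, 2, 3, 4}" "finite S" "r \<notin> S" for r S h
    using sum.reindex_bij_betw[OF bij_betw_monoms_insert[OF that], symmetric]
    by (simp add: sum.cartesian_product case_prod_unfold)
  show ?thesis
    using assms by (simp add: 1 monoms_empty sum.cartesian_product)
qed

section \<open>Derivatives of multilinear polynomials\<close>

definition multilinear :: "'a::field polynomial \<Rightarrow> bool" where
  "multilinear p \<longleftrightarrow> (\<forall>b v. Poly_Mapping.lookup p b \<noteq> 0 \<longrightarrow> Poly_Mapping.lookup b v \<le> 1)"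

text \<open>Wherever the shifted coefficient is nonzero, the exponent of \<open>v\<close> in
  \<open>b\<close> is 0 and the factor produced by differentiation is 1. The characteristic of the
  field therefore never enters.\<close>

lemma lookup_partial_deriv_multilinear:
  assumes "multilinear p"
  shows "Poly_Mapping.lookup (partial_deriv v p) b = Poly_Mapping.lookup p (b + var_monom v)"
proof (cases "Poly_Mapping.lookup p (b + var_monom v) = 0")
  case False
  then have "Poly_Mapping.lookup (b + var_monom v) v \<le> 1"
    using assms unfolding multilinear_def by blast
  then have "Poly_Mapping.lookup b v = 0" by (simp add: lookup_add)
  then show ?thesis by (simp add: lookup_partial_deriv)
qed (simp add: lookup_partial_deriv)

lemma multilinear_shift:
  assumes "multilinear p" "\<And>b. Poly_Mapping.lookup q b = Poly_Mapping.lookup p (b + c)"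
  shows "multilinear q"
  unfolding multilinear_def
proof (intro allI impI)
  fix b v assume "Poly_Mapping.lookup q b \<noteq> 0"
  then have "Poly_Mapping.lookup (b + c) v \<le> 1"
    using assms unfolding multilinear_def by metis
  then show "Poly_Mapping.lookup b v \<le> 1" by (simp add: lookup_add)
qed

lemma lookup_partial_deriv_funpow:
  assumes "multilinear p"
  shows "Poly_Mapping.lookup ((partial_deriv v ^^ n) p) b =
    Poly_Mapping.lookup p (b + Poly_Mapping.single v n)"
proof (induction n arbitrary: b)
  case (Suc n)
  have "multilinear ((partial_deriv v ^^ n) p)"
    using assms Suc by (rule multilinear_shift)
  then show ?case
    by (simp add: lookup_partial_deriv_multilinear Suc add.assoc flip: single_add)
qed simp

text \<open>Each partial derivative shifts coefficients and preserves multilinearity, so the shifts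
  add up to \<open>a\<close>. The derivatives are thus the rows of a catalecticant matrix with
  entries \<open>lookup f (a + b)\<close>.\<close>

lemma lookup_monom_diff:
  fixes f :: "'a::field polynomial"
  assumes "multilinear f"
  shows "Poly_Mapping.lookup (monom_diff a f) b = Poly_Mapping.lookup f (b + a)"
proof -
  interpret comp_fun_commute "\<lambda>v. (partial_deriv v :: 'a polynomial \<Rightarrow> _) ^^ Poly_Mapping.lookup a v"
    by (rule comp_fun_commute_partial_deriv)
  let ?D = "\<lambda>V. Finite_Set.fold (\<lambda>v. partial_deriv v ^^ Poly_Mapping.lookup a v) f V"
  let ?s = "\<lambda>V. \<Sum>v\<in>V. Poly_Mapping.single v (Poly_Mapping.lookup a v)"
  have "Poly_Mapping.lookup (?D V) b = Poly_Mapping.lookup f (b + ?s V)" if "finite V" for V b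
    using that
  proof (induction V arbitrary: b)
    case (insert v V)
    have "multilinear (?D V)" using assms insert.IH by (rule multilinear_shift)
    with insert show ?case by (simp add: lookup_partial_deriv_funpow add.assoc)
  qed simp
  moreover have "?s (Poly_Mapping.keys a) = a"
    by (rule poly_mapping_eqI)
       (auto simp: lookup_sum lookup_single when_def sum.delta in_keys_iff)
  ultimately show ?thesis by (simp add: monom_diff_def)
qed

section \<open>From independent derivatives to dimensions\<close>

definition derivs_independent :: "nat \<Rightarrow> 'a::field polynomial \<Rightarrow> nat set \<Rightarrow> bool" where
  "derivs_independent k f S \<longleftrightarrow>
     rows_independent (monoms k S) UNIV (\<lambda>a b. Poly_Mapping.lookup f (a + b))"

text \<open>Applying a fixed monomial \<open>c\<close> of degree \<open>T - S\<close> to a linear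
  relation among the derivatives for \<open>S\<close> yields a relation with the same coefficients
  for \<open>T\<close>.\<close>

lemma derivs_independent_subset:
  assumes "derivs_independent k f T" "S \<subseteq> T" "T \<subseteq> {1, 2, 3, 4}" "k > 0"
  shows "derivs_independent k f S"
  unfolding derivs_independent_def
proof (rule rows_independentI)
  fix u a
  assume u: "\<And>b. b \<in> UNIV \<Longrightarrow> (\<Sum>a\<in>monoms k S. u a * Poly_Mapping.lookup f (a + b)) = 0"
    and a: "a \<in> monoms k S"
  have fin: "finite T" "finite S"
    using finite_subset[OF assms(3)] finite_subset[OF assms(2)] by auto
  have "card (monoms k (T - S)) > 0" using assms by (subst card_monoms) auto
  then obtain c where c: "c \<in> monoms k (T - S)" by (metis card_gt_0_iff ex_in_conv)
  have mem: "x + c \<in> monoms k T" if "x \<in> monoms k S" for x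
    using monoms_add[OF that c] fin assms by (simp add: Un_absorb1)
  \<comment> \<open>The coefficient of \<open>x\<close> is moved to \<open>x + c\<close>; monomials
    not divisible in this way get coefficient 0.\<close>
  define w where "w x = (if x \<in> (\<lambda>x. x + c) ` monoms k S then u (x - c) else 0)" for x
  have w: "w (x + c) = u x" if "x \<in> monoms k S" for x
    using that by (auto simp: w_def)
  have "w (a + c) = 0"
  proof (rule rows_independentD[OF assms(1)[unfolded derivs_independent_def]])
    show "a + c \<in> monoms k T" using mem a .
    fix b
    have "(\<Sum>x\<in>monoms k T. w x * Poly_Mapping.lookup f (x + b)) =
        (\<Sum>x\<in>(\<lambda>x. x + c) ` monoms k S. w x * Poly_Mapping.lookup f (x + b))"
      by (rule sum.mono_neutral_right) (use mem assms finite_monoms in \<open>auto simp: w_def\<close>)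
    also have "\<dots> = (\<Sum>x\<in>monoms k S. w (x + c) * Poly_Mapping.lookup f (x + c + b))"
      by (subst sum.reindex) (auto simp: inj_on_def)
    also have "\<dots> = (\<Sum>x\<in>monoms k S. u x * Poly_Mapping.lookup f (x + (c + b)))"
      by (rule sum.cong) (simp_all add: w add.assoc)
    also have "\<dots> = 0" using u by simp
    finally show "(\<Sum>x\<in>monoms k T. w x * Poly_Mapping.lookup f (x + b)) = 0" .
  qed
  with w a show "u a = 0" by simp
qed

lemma lookup_smult_poly: "Poly_Mapping.lookup (smult_poly c p) b = c * Poly_Mapping.lookup p b"
  by (simp add: smult_poly_def flip: mult_map_scale_conv_mult) (simp add: Poly_Mapping.map.rep_eq when_def)

text \<open>The space is spanned by the derivatives along the monomials of degree
  \<open>set_deg S\<close>. Independence makes them a basis, and their number is that of the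
  monomials.\<close>

lemma H_eq_power:
  fixes f :: "'a::field polynomial"
  assumes f: "multilinear f" "derivs_independent k f S" and S: "S \<subseteq> {1, 2, 3, 4}"
  shows "H k f S = k ^ card S"
proof -
  let ?D = "\<lambda>a. monom_diff a f"
  let ?M = "monoms k S"
  have fin: "finite ?M" using finite_monoms[OF S] .
  have indep: "u a = 0" if "(\<Sum>a\<in>?M. smult_poly (u a) (?D a)) = 0" "a \<in> ?M" for u a
  proof (rule rows_independentD[OF f(2)[unfolded derivs_independent_def] _ that(2)])
    fix b
    have "Poly_Mapping.lookup (\<Sum>a\<in>?M. smult_poly (u a) (?D a)) b = 0" using that(1) by simp
    then show "(\<Sum>a\<in>?M. u a * Poly_Mapping.lookup f (a + b)) = 0"
      by (simp add: lookup_sum lookup_monom_diff[OF f(1)] lookup_smult_poly add.commute)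
  qed
  \<comment> \<open>Independence of a set of vectors would not see repetitions; two equal
    derivatives are excluded by the relation with coefficients 1 and -1.\<close>
  have inj: "inj_on ?D ?M"
  proof (rule inj_onI, rule ccontr)
    fix a c assume ac: "a \<in> ?M" "c \<in> ?M" "?D a = ?D c" "a \<noteq> c"
    define u :: "(var \<Rightarrow>\<^sub>0 nat) \<Rightarrow> 'a" where "u x = (if x = a then 1 else if x = c then - 1 else 0)" for x
    have "(\<Sum>x\<in>?M. smult_poly (u x) (?D x)) = (\<Sum>x\<in>{a, c}. smult_poly (u x) (?D x))"
      by (rule sum.mono_neutral_right) (use ac fin in \<open>auto simp: u_def\<close>)
    also have "\<dots> = 0" using ac by (simp add: u_def)
    finally have "u a = 0" using indep ac by blast
    then show False by (simp add: u_def)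
  qed
  have "poly_space.independent (?D ` ?M)"
    unfolding poly_space.dependent_finite[OF finite_imageI[OF fin]]
  proof clarify
    fix u a
    assume "a \<in> ?M" "u (?D a) \<noteq> 0" "(\<Sum>v\<in>?D ` ?M. smult_poly (u v) v) = 0"
    then show False using indep[of "\<lambda>a. u (?D a)" a] by (simp add: sum.reindex[OF inj])
  qed
  moreover have "{poly_diff g f | g. g \<in> graded_component k (set_deg S)} = poly_space.span (?D ` ?M)"
  proof (intro equalityI subsetI)
    fix h assume "h \<in> {poly_diff g f | g. g \<in> graded_component k (set_deg S)}"
    then obtain g where "h = poly_diff g f" "Poly_Mapping.keys g \<subseteq> ?M"
      by (auto simp: graded_component_def ring_R_def monoms_def)
    then show "h \<in> poly_space.span (?D ` ?M)"
      unfolding poly_diff_def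
      by (auto intro!: poly_space.span_sum poly_space.span_scale intro: poly_space.span_base)
  next
    fix h assume "h \<in> poly_space.span (?D ` ?M)"
    then obtain u where "h = (\<Sum>v\<in>?D ` ?M. smult_poly (u v) v)"
      using poly_space.span_finite[OF finite_imageI[OF fin]] by auto
    then have h: "h = (\<Sum>a\<in>?M. smult_poly (u (?D a)) (?D a))"
      by (simp add: sum.reindex[OF inj] o_def)
    define g where "g = (\<Sum>a\<in>?M. Poly_Mapping.single a (u (?D a)))"
    have g: "Poly_Mapping.lookup g a = (if a \<in> ?M then u (?D a) else 0)" for a
      using fin by (simp add: g_def lookup_sum lookup_single when_def)
    then have keys: "Poly_Mapping.keys g \<subseteq> ?M"
      by (auto simp: in_keys_iff split: if_splits)
    have "poly_diff g f = (\<Sum>a\<in>?M. smult_poly (Poly_Mapping.lookup g a) (?D a))"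
      unfolding poly_diff_def
      by (rule sum.mono_neutral_left) (use fin keys in \<open>auto simp: in_keys_iff\<close>)
    then have "h = poly_diff g f" using h g by simp
    moreover have "g \<in> graded_component k (set_deg S)"
      using keys by (auto simp: graded_component_def ring_R_def monoms_def)
    ultimately show "h \<in> {poly_diff g f | g. g \<in> graded_component k (set_deg S)}" by blast
  qed
  ultimately have "H k f S = card (?D ` ?M)"
    by (simp add: H_def poly_space.dim_eq_card_independent)
  also have "\<dots> = k ^ card S" using card_monoms[OF S] inj by (simp add: card_image)
  finally show ?thesis .
qed

text \<open>A relation holds in every column, in particular in those of the square block indexed by
  positions \<open>r\<close> and \<open>s\<close>, so independence within that block
  suffices.\<close>

lemma derivs_independent_pair:
  assumes pq: "p \<in> {1, 2, 3, 4}" "q \<in> {1, 2, 3, 4}" "p \<noteq> q"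
    and rows: "rows_independent ({1..k} \<times> {1..k}) ({1..k} \<times> {1..k}) (\<lambda>(i, j) (i', j').
      Poly_Mapping.lookup f (var_monom (var_of p i) + var_monom (var_of q j) +
        (var_monom (var_of r i') + var_monom (var_of s j'))))"
  shows "derivs_independent k f {p, q}"
  unfolding derivs_independent_def
proof (rule rows_independentI)
  fix u a
  assume u: "\<And>b. b \<in> UNIV \<Longrightarrow> (\<Sum>a\<in>monoms k {p, q}. u a * Poly_Mapping.lookup f (a + b)) = 0"
    and a: "a \<in> monoms k {p, q}"
  let ?e = "\<lambda>(i, j). var_monom (var_of p i) + var_monom (var_of q j)"
  have 0: "u (?e x) = 0" if "x \<in> {1..k} \<times> {1..k}" for x
  proof (rule rows_independentD[OF rows _ that, of "\<lambda>x. u (?e x)"])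
    fix c
    show "(\<Sum>x\<in>{1..k} \<times> {1..k}. u (?e x) * (case x of (i, j) \<Rightarrow> \<lambda>(i', j').
      Poly_Mapping.lookup f (var_monom (var_of p i) + var_monom (var_of q j) +
        (var_monom (var_of r i') + var_monom (var_of s j')))) c) = 0"
      using u[of "var_monom (var_of r (fst c)) + var_monom (var_of s (snd c))"]
      by (simp add: sum_monoms_pair[OF pq] case_prod_unfold)
  qed
  have "monoms k {p, q} = (\<lambda>(i, a). var_monom (var_of p i) + a) ` ({1..k} \<times> monoms k {q})"
    using bij_betw_imp_surj_on[OF bij_betw_monoms_insert[of p "{q}" k]] pq by simp
  moreover have "monoms k {q} = (\<lambda>(i, a). var_monom (var_of q i) + a) ` ({1..k} \<times> {0})"
    using bij_betw_imp_surj_on[OF bij_betw_monoms_insert[of q "{}" k]] pq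
    by (simp add: monoms_empty)
  ultimately obtain x where "x \<in> {1..k} \<times> {1..k}" "a = ?e x" using a by auto
  with 0 show "u a = 0" by simp
qed

section \<open>The coefficients of the polynomial\<close>

definition mono4 :: "nat \<Rightarrow> nat \<Rightarrow> nat \<Rightarrow> nat \<Rightarrow> (var \<Rightarrow>\<^sub>0 nat)" where
  "mono4 a b c d = var_monom (X a) + var_monom (Y b) + var_monom (Z c) + var_monom (W d)"

lemma lookup_mono4:
  "Poly_Mapping.lookup (mono4 a b c d) (X i) = of_bool (i = a)"
  "Poly_Mapping.lookup (mono4 a b c d) (Y i) = of_bool (i = b)"
  "Poly_Mapping.lookup (mono4 a b c d) (Z i) = of_bool (i = c)"
  "Poly_Mapping.lookup (mono4 a b c d) (W i) = of_bool (i = d)"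
  by (auto simp: mono4_def lookup_add lookup_single when_def)

lemma mono4_eq_iff: "mono4 a b c d = mono4 a' b' c' d' \<longleftrightarrow> a = a' \<and> b = b' \<and> c = c' \<and> d = d'"
proof
  assume eq: "mono4 a b c d = mono4 a' b' c' d'"
  note 1 = lookup_mono4[of a b c d, unfolded eq lookup_mono4]
  have "a = a'" using 1(1)[of a] by (simp add: of_bool_def split: if_splits)
  moreover have "b = b'" using 1(2)[of b] by (simp add: of_bool_def split: if_splits)
  moreover have "c = c'" using 1(3)[of c] by (simp add: of_bool_def split: if_splits)
  moreover have "d = d'" using 1(4)[of d] by (simp add: of_bool_def split: if_splits)
  ultimately show "a = a' \<and> b = b' \<and> c = c' \<and> d = d'" by blast
qed simp

lemma lookup_mono4_le: "Poly_Mapping.lookup (mono4 a b c d) v \<le> 1"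
  by (cases v) (simp_all add: lookup_mono4)

lemma mono4_in_monoms:
  assumes "a \<in> {1..k}" "b \<in> {1..k}" "c \<in> {1..k}" "d \<in> {1..k}"
  shows "mono4 a b c d \<in> monoms k {1, 2, 3, 4}"
proof -
  have "var_index v \<in> {1..k}" if "v \<in> Poly_Mapping.keys (mono4 a b c d)" for v
    using that assms by (cases v) (auto simp: in_keys_iff lookup_mono4)
  moreover have "monom_deg (mono4 a b c d) q = set_deg {1, 2, 3, 4} q" for q
    by (simp add: mono4_def monom_deg_add set_deg_def)
  ultimately show ?thesis by (auto simp: monoms_def)
qed

lemma var_poly_mult4:
  "var_poly (X a) * var_poly (Y b) * var_poly (Z c) * var_poly (W d) =
     Poly_Mapping.single (mono4 a b c d) 1"
  by (simp add: var_poly_def mult_single mono4_def)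

text \<open>Residues start at 0 and indices at 1, hence the shift by 1; odd parity plays the part of
  the overline.\<close>

lemma decode_eq_cyc:
  assumes "[v = u - 1] (mod (2 * int m + 1))"
  shows "decode m v = cyc (2 * m + 1) u + (if odd v then 2 * m + 1 else 0)"
  using assms by (simp add: cyc_def decode_def cong_def add.commute)

lemma cong_code_shift:
  "[code m (i + of_bool p * (2 * m + 1)) = int i - 1] (mod (2 * int m + 1))"
proof -
  have "[int (i + of_bool p * (2 * m + 1)) - 1 = int i - 1] (mod (2 * int m + 1))"
    by (cases p) (simp_all add: cong_iff_dvd_diff)
  with cong_code show ?thesis by (rule cong_trans)
qed

text \<open>The flags mark overlined \<open>x\<close> and \<open>y\<close>. Parities add, so
  \<open>z\<close> is overlined exactly when one of them is.\<close>

lemma decode_code_add_code: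
  assumes "i \<in> {1..2 * m + 1}" "j \<in> {1..2 * m + 1}"
  shows "decode m (code m (j + of_bool q * (2 * m + 1)) + code m (i + of_bool p * (2 * m + 1))) =
    cyc (2 * m + 1) (int i + int j - 1) + of_bool (p \<noteq> q) * (2 * m + 1)"
proof -
  have "[code m (j + of_bool q * (2 * m + 1)) + code m (i + of_bool p * (2 * m + 1)) =
      (int j - 1) + (int i - 1)] (mod (2 * int m + 1))"
    by (intro cong_add cong_code_shift)
  then have "[code m (j + of_bool q * (2 * m + 1)) + code m (i + of_bool p * (2 * m + 1)) =
      (int i + int j - 1) - 1] (mod (2 * int m + 1))" by (simp add: algebra_simps)
  from decode_eq_cyc[OF this] assms show ?thesis by (auto simp: even_code)
qed

text \<open>Here \<open>a\<close> is the full index, including the offset of an overlined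
  \<open>x\<close>. Since \<open>wshift m a\<close> has the parity of \<open>a - 1\<close>, the
  overline of \<open>w\<close> depends on \<open>q\<close> and the parity of
  \<open>a\<close>.\<close>

lemma decode_code_add_wshift:
  assumes "j \<in> {1..2 * m + 1}"
  shows "decode m (code m (j + of_bool q * (2 * m + 1)) + wshift m a) =
    cyc (2 * m + 1) ((int a - 1) div 2 + int j) + of_bool (q = odd a) * (2 * m + 1)"
proof -
  have "[code m (j + of_bool q * (2 * m + 1)) + wshift m a =
      (int j - 1) + (int a - 1) div 2] (mod (2 * int m + 1))"
    by (intro cong_add cong_code_shift cong_wshift)
  then have "[code m (j + of_bool q * (2 * m + 1)) + wshift m a =
      ((int a - 1) div 2 + int j) - 1] (mod (2 * int m + 1))" by (simp add: algebra_simps)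
  from decode_eq_cyc[OF this] assms show ?thesis by (auto simp: even_code even_wshift)
qed

lemma sum_double_range:
  fixes m :: nat
  shows "(\<Sum>a\<in>{1..4 * m + 2}. g a) = (\<Sum>i\<in>{1..2 * m + 1}. g i + g (i + (2 * m + 1)))"
proof -
  have "(\<lambda>i. i + (2 * m + 1)) ` {1..2 * m + 1} = {1 + (2 * m + 1)..2 * m + 1 + (2 * m + 1)}"
    by (rule image_add_atLeastAtMost')
  then have "{1..4 * m + 2} = {1..2 * m + 1} \<union> (\<lambda>i. i + (2 * m + 1)) ` {1..2 * m + 1}"
    by auto
  then have "(\<Sum>a\<in>{1..4 * m + 2}. g a) =
      (\<Sum>i\<in>{1..2 * m + 1}. g i) + (\<Sum>a\<in>(\<lambda>i. i + (2 * m + 1)) ` {1..2 * m + 1}. g a)"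
    by (simp only:) (rule sum.union_disjoint; auto)
  also have "(\<Sum>a\<in>(\<lambda>i. i + (2 * m + 1)) ` {1..2 * m + 1}. g a) =
      (\<Sum>i\<in>{1..2 * m + 1}. g (i + (2 * m + 1)))"
    by (subst sum.reindex) (auto simp: inj_on_def)
  finally show ?thesis by (simp only: sum.distrib)
qed

lemma sum_odds_evens: "(\<Sum>i\<in>{1..n}. g i) = (\<Sum>i\<in>odds n. g i) + (\<Sum>i\<in>evens n. g i)"
proof -
  have "{1..n} = odds n \<union> evens n" by (auto simp: odds_def evens_def)
  then show ?thesis
    by (simp only:) (rule sum.union_disjoint; auto simp: odds_def evens_def)
qed

text \<open>The eight double sums are the cases of one double sum: \<open>x\<close> plain or
  overlined, \<open>y\<close> plain or overlined, \<open>i\<close> odd or even. The two single sums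
  are the plain and overlined \<open>y\<close> in the extra terms.\<close>

lemma nbly_poly_eq:
  "nbly_poly m =
    (\<Sum>a\<in>{1..4 * m + 2}. \<Sum>b\<in>{1..4 * m + 2}. Poly_Mapping.single
      (mono4 a b (decode m (code m b + code m a)) (decode m (code m b + wshift m a))) 1) +
    (\<Sum>b\<in>{1..4 * m + 2}. Poly_Mapping.single
      (mono4 (4 * m + 2) b (decode m (code m b + (2 * int m + 1))) (decode m (code m b))) 1)"
proof -
  let ?n = "2 * m + 1"
  let ?c = "cyc ?n"
  define P :: "nat \<Rightarrow> nat \<Rightarrow> nat \<Rightarrow> nat \<Rightarrow> 'a polynomial" where
    "P a b c d = var_poly (X a) * var_poly (Y b) * var_poly (Z c) * var_poly (W d)" for a b c d
  define T where
    "T a b = P a b (decode m (code m b + code m a)) (decode m (code m b + wshift m a))" for a b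
  define E where
    "E b = P (4 * m + 2) b (decode m (code m b + (2 * int m + 1))) (decode m (code m b))" for b
  have T: "T (i + of_bool p * ?n) (j + of_bool q * ?n) = P (i + of_bool p * ?n) (j + of_bool q * ?n)
      (?c (int i + int j - 1) + of_bool (p \<noteq> q) * ?n)
      (?c ((int (i + of_bool p * ?n) - 1) div 2 + int j) + of_bool (q = odd (i + of_bool p * ?n)) * ?n)"
    if "i \<in> {1..?n}" "j \<in> {1..?n}" for i j p q
    unfolding T_def decode_code_add_code[OF that] decode_code_add_wshift[OF that(2)] ..
  \<comment> \<open>Overlining adds \<open>2 * m + 1\<close> to the index, whose half produces the
    offset \<open>m\<close> in the \<open>w\<close> index; the odd remainder is absorbed according
    to the parity of \<open>i\<close>.\<close>
  have div_odd: "(int (i + ?n) - 1) div 2 + int j = (int i - 1) div 2 + int j + int m"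
    if "odd i" for i j
    using that by simp presburger
  have div_even: "(int (i + ?n) - 1) div 2 + int j = int i div 2 + int j + int m"
    "(int i - 1) div 2 = (int i - 2) div 2"
    if "even i" for i j
    using that by (simp, presburger)
  have odd: "T i j = P i j (?c (int i + int j - 1)) (?c ((int i - 1) div 2 + int j))"
    "T (i + ?n) j =
      P (i + ?n) j (?c (int i + int j - 1) + ?n) (?c ((int i - 1) div 2 + int j + int m) + ?n)"
    "T i (j + ?n) = P i (j + ?n) (?c (int i + int j - 1) + ?n) (?c ((int i - 1) div 2 + int j) + ?n)"
    "T (i + ?n) (j + ?n) =
      P (i + ?n) (j + ?n) (?c (int i + int j - 1)) (?c ((int i - 1) div 2 + int j + int m))"
    if "i \<in> odds ?n" "j \<in> {1..?n}" for i j
  proof -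
    have i: "i \<in> {1..?n}" "odd i" using that(1) by (auto simp: odds_def)
    note T' = T[OF i(1) that(2)]
    show "T i j = P i j (?c (int i + int j - 1)) (?c ((int i - 1) div 2 + int j))"
      using T'[of False False] i by simp
    show "T (i + ?n) j =
        P (i + ?n) j (?c (int i + int j - 1) + ?n) (?c ((int i - 1) div 2 + int j + int m) + ?n)"
      using T'[of True False] i unfolding div_odd[OF i(2), symmetric] by simp
    show "T i (j + ?n) =
        P i (j + ?n) (?c (int i + int j - 1) + ?n) (?c ((int i - 1) div 2 + int j) + ?n)"
      using T'[of False True] i by simp
    show "T (i + ?n) (j + ?n) =
        P (i + ?n) (j + ?n) (?c (int i + int j - 1)) (?c ((int i - 1) div 2 + int j + int m))"
      using T'[of True True] i unfolding div_odd[OF i(2), symmetric] by simp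
  qed
  have even: "T i j = P i j (?c (int i + int j - 1)) (?c ((int i - 2) div 2 + int j) + ?n)"
    "T (i + ?n) j = P (i + ?n) j (?c (int i + int j - 1) + ?n) (?c (int i div 2 + int j + int m))"
    "T i (j + ?n) = P i (j + ?n) (?c (int i + int j - 1) + ?n) (?c ((int i - 2) div 2 + int j))"
    "T (i + ?n) (j + ?n) =
      P (i + ?n) (j + ?n) (?c (int i + int j - 1)) (?c (int i div 2 + int j + int m) + ?n)"
    if "i \<in> evens ?n" "j \<in> {1..?n}" for i j
  proof -
    have i: "i \<in> {1..?n}" "even i" using that(1) by (auto simp: evens_def)
    note T' = T[OF i(1) that(2)]
    show "T i j = P i j (?c (int i + int j - 1)) (?c ((int i - 2) div 2 + int j) + ?n)"
      using T'[of False False] i unfolding div_even(2)[OF i(2), symmetric] by simp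
    show "T (i + ?n) j =
        P (i + ?n) j (?c (int i + int j - 1) + ?n) (?c (int i div 2 + int j + int m))"
      using T'[of True False] i unfolding div_even(1)[OF i(2), symmetric] by simp
    show "T i (j + ?n) =
        P i (j + ?n) (?c (int i + int j - 1) + ?n) (?c ((int i - 2) div 2 + int j))"
      using T'[of False True] i unfolding div_even(2)[OF i(2), symmetric] by simp
    show "T (i + ?n) (j + ?n) =
        P (i + ?n) (j + ?n) (?c (int i + int j - 1)) (?c (int i div 2 + int j + int m) + ?n)"
      using T'[of True True] i unfolding div_even(1)[OF i(2), symmetric] by simp
  qed
  have E: "E j = P (?n + ?n) j (j + ?n) j" "E (j + ?n) = P (?n + ?n) (j + ?n) j (j + ?n)"
    if "j \<in> {1..?n}" for j
  proof -
    have 1: "decode m (code m j) = j" "decode m (code m (j + ?n)) = j + ?n"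
      by (rule decode_code; use that in simp)+
    have 2: "[code m (j + ?n) = code m j] (mod (2 * int m + 1))"
      using cong_code_shift[of m j True] cong_code[of m j] by (simp add: cong_def)
    have 3: "even (code m j)" "odd (code m (j + ?n))" using that by (auto simp: even_code)
    \<comment> \<open>Adding \<open>2 * m + 1\<close> keeps the residue modulo
      \<open>2 * m + 1\<close> and flips the parity, so it exchanges an index with its overlined
      version.\<close>
    have "[code m (j + ?n) = code m j + (2 * int m + 1)] (mod (4 * int m + 2))"
      "[code m j = code m (j + ?n) + (2 * int m + 1)] (mod (4 * int m + 2))"
      using 2 3 unfolding cong_iff_parity by (simp_all add: cong_def)
    then have 4: "decode m (code m j + (2 * int m + 1)) = j + ?n"
      "decode m (code m (j + ?n) + (2 * int m + 1)) = j"
      using 1 decode_eq_iff by metis+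
    have 5: "4 * m + 2 = ?n + ?n" by simp
    show "E j = P (?n + ?n) j (j + ?n) j" "E (j + ?n) = P (?n + ?n) (j + ?n) j (j + ?n)"
      unfolding E_def 1 4 5 by (rule refl)+
  qed
  have "(\<Sum>a\<in>{1..4 * m + 2}. \<Sum>b\<in>{1..4 * m + 2}. T a b) + (\<Sum>b\<in>{1..4 * m + 2}. E b) =
      (\<Sum>i\<in>odds ?n. \<Sum>j\<in>{1..?n}. T i j) + (\<Sum>i\<in>odds ?n. \<Sum>j\<in>{1..?n}. T (i + ?n) j) +
      (\<Sum>i\<in>odds ?n. \<Sum>j\<in>{1..?n}. T i (j + ?n)) + (\<Sum>i\<in>odds ?n. \<Sum>j\<in>{1..?n}. T (i + ?n) (j + ?n)) +
      (\<Sum>i\<in>evens ?n. \<Sum>j\<in>{1..?n}. T i j) + (\<Sum>i\<in>evens ?n. \<Sum>j\<in>{1..?n}. T (i + ?n) j) +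
      (\<Sum>i\<in>evens ?n. \<Sum>j\<in>{1..?n}. T i (j + ?n)) + (\<Sum>i\<in>evens ?n. \<Sum>j\<in>{1..?n}. T (i + ?n) (j + ?n)) +
      (\<Sum>j\<in>{1..?n}. E j) + (\<Sum>j\<in>{1..?n}. E (j + ?n))"
  proof -
    have "(\<Sum>a\<in>{1..4 * m + 2}. \<Sum>b\<in>{1..4 * m + 2}. T a b) =
        (\<Sum>i\<in>{1..?n}. \<Sum>j\<in>{1..?n}. T i j) + (\<Sum>i\<in>{1..?n}. \<Sum>j\<in>{1..?n}. T i (j + ?n)) +
        (\<Sum>i\<in>{1..?n}. \<Sum>j\<in>{1..?n}. T (i + ?n) j) +
        (\<Sum>i\<in>{1..?n}. \<Sum>j\<in>{1..?n}. T (i + ?n) (j + ?n))"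
      unfolding sum_double_range sum.distrib
      by (simp only: add.assoc add.commute add.left_commute)
    then show ?thesis
      unfolding sum_odds_evens[of "\<lambda>i. sum (_ i) _"] sum_double_range[of E] sum.distrib
      by (simp only: add.assoc add.commute add.left_commute)
  qed
  also have "\<dots> = nbly_poly m"
  proof -
    have half: "(4 * m + 2) div 2 = ?n" by simp
    show ?thesis
      unfolding nbly_poly_def Let_def half
      by (intro arg_cong2[of _ _ _ _ "(+)"] sum.cong refl) (simp_all only: odd even E P_def)
  qed
  finally show ?thesis unfolding T_def E_def P_def var_poly_mult4 by (rule sym)
qed

text \<open>Both families of monomials are parametrised by the \<open>x\<close> and \<open>y\<close>
  indices, so fixed \<open>a\<close> and \<open>b\<close> leave at most one candidate from
  each.\<close>

lemma lookup_nbly_poly: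
  assumes "a \<in> {1..4 * m + 2}" "b \<in> {1..4 * m + 2}"
  shows "Poly_Mapping.lookup (nbly_poly m) (mono4 a b c d) =
    of_bool (c = decode m (code m b + code m a) \<and> d = decode m (code m b + wshift m a)) +
    of_bool (a = 4 * m + 2 \<and> c = decode m (code m b + (2 * int m + 1)) \<and> d = decode m (code m b))"
proof -
  let ?I = "{1..4 * m + 2}"
  have 1: "(\<Sum>a'\<in>?I. \<Sum>b'\<in>?I. (if a' = a \<and> b' = b \<and> P a' b' then 1 else 0)) =
      (of_bool (P a b) :: 'a)" for P
  proof -
    have "(\<Sum>a'\<in>?I. \<Sum>b'\<in>?I. (if a' = a \<and> b' = b \<and> P a' b' then 1 else 0)) =
        (\<Sum>x\<in>?I \<times> ?I. if x = (a, b) then of_bool (P a b) else 0 :: 'a)"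
      unfolding sum.cartesian_product by (rule sum.cong) (auto split: if_splits)
    then show ?thesis using assms by simp
  qed
  have 2: "(\<Sum>b'\<in>?I. (if Q \<and> b' = b \<and> P b' then 1 else 0)) = (of_bool (Q \<and> P b) :: 'a)" for P Q
  proof -
    have "(\<Sum>b'\<in>?I. (if Q \<and> b' = b \<and> P b' then 1 else 0)) =
        (\<Sum>b'\<in>?I. if b' = b then of_bool (Q \<and> P b) else 0 :: 'a)"
      by (intro sum.cong refl) auto
    then show ?thesis using assms by simp
  qed
  show ?thesis
    unfolding nbly_poly_eq lookup_add lookup_sum lookup_single when_def mono4_eq_iff
    unfolding 1
    unfolding 2
    by (intro arg_cong2[of _ _ _ _ "(+)"] arg_cong[of _ _ of_bool]) blast+
qed

lemma keys_nbly_poly: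
  "Poly_Mapping.keys (nbly_poly m :: 'a::field polynomial) \<subseteq>
     {mono4 a b c d | a b c d. {a, b, c, d} \<subseteq> {1..4 * m + 2}}" (is "_ \<subseteq> ?S")
proof -
  have mem: "Poly_Mapping.keys (Poly_Mapping.single (mono4 a b c d) (1 :: 'a)) \<subseteq> ?S"
    if "a \<in> {1..4 * m + 2}" "b \<in> {1..4 * m + 2}" "c \<in> {1..4 * m + 2}" "d \<in> {1..4 * m + 2}"
    for a b c d
    using that by auto
  have top: "4 * m + 2 \<in> {1..4 * m + 2}" by simp
  show ?thesis
    unfolding nbly_poly_eq
    by (intro order_trans[OF keys_add] Un_least order_trans[OF keys_sum] UN_least mem decode_mem top)
qed

lemma multilinear_nbly_poly: "multilinear (nbly_poly m)"
  unfolding multilinear_def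
proof (intro allI impI)
  fix b v assume "Poly_Mapping.lookup (nbly_poly m :: 'a polynomial) b \<noteq> 0"
  then have "b \<in> Poly_Mapping.keys (nbly_poly m :: 'a polynomial)" by (simp add: in_keys_iff)
  then show "Poly_Mapping.lookup b v \<le> 1" using keys_nbly_poly lookup_mono4_le by blast
qed

section \<open>The three splittings of the four blocks into pairs\<close>

lemma lookup_nbly_poly_cong:
  assumes "a \<in> {1..4 * m + 2}" "b \<in> {1..4 * m + 2}" "c \<in> {1..4 * m + 2}" "d \<in> {1..4 * m + 2}"
  shows "Poly_Mapping.lookup (nbly_poly m) (mono4 a b c d) =
    of_bool ([code m c = code m b + code m a] (mod (4 * int m + 2)) \<and>
      [code m d = code m b + wshift m a] (mod (4 * int m + 2))) +
    of_bool (a = 4 * m + 2 \<and> [code m c = code m b + (2 * int m + 1)] (mod (4 * int m + 2)) \<and>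
      [code m d = code m b] (mod (4 * int m + 2)))"
  unfolding lookup_nbly_poly[OF assms(1,2)] eq_decode_iff[OF assms(3)] eq_decode_iff[OF assms(4)] ..

text \<open>This changes the parameter from the \<open>y\<close> index (here \<open>p\<close>) to
  the \<open>z\<close> or \<open>w\<close> index (here \<open>y\<close>), as required when that
  index labels the rows.\<close>

lemma cong_pair_solve:
  fixes p q y s t n :: int
  shows "[p = y + - s] (mod n) \<and> [q = y + (t - s)] (mod n) \<longleftrightarrow>
    [y = p + s] (mod n) \<and> [q = p + t] (mod n)"
proof -
  have "p - (y + - s) = - (y - (p + s))" and "q - (y + (t - s)) = (q - (p + t)) - (y - (p + s))"
    by simp_all
  then show ?thesis
    unfolding cong_iff_dvd_diff by (metis dvd_diff_left_iff dvd_minus_iff)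
qed

text \<open>Since \<open>code - wshift\<close> repeats a value at the last index, the roles are
  exchanged there: the extra term belongs to the permutation, and the regular term becomes the
  additional entry. Its difference class is 0, the one of \<open>a0 = 1\<close>.\<close>

lemma rows_independent_xy_zw:
  fixes m :: nat
  defines "M \<equiv> \<lambda>(a, b) (c, d). Poly_Mapping.lookup (nbly_poly m :: 'a::field polynomial) (mono4 a b c d)"
    and "I \<equiv> {1..4 * m + 2} \<times> {1..4 * m + 2}"
  shows "rows_independent I I M" "rows_independent I I (\<lambda>c r. M r c)"
proof -
  define U where "U a = (if a = 4 * m + 2 then 2 * int m + 1 else code m a)" for a
  define V where "V a = (if a = 4 * m + 2 then 0 else wshift m a)" for a
  have UV: "U a - V a = (if a = 4 * m + 2 then 2 * int m + 1 else code m a - wshift m a)" for a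
    by (simp add: U_def V_def)
  have inj: "a = b" if "a \<in> {1..4 * m + 2}" "b \<in> {1..4 * m + 2}"
    "[U a - V a = U b - V b] (mod (4 * int m + 2))" for a b
    using inj_code_minus_wshift[OF that(1,2)] that(3) unfolding UV by simp
  have 1: "1 \<in> {1..<4 * m + 2}" by simp
  have "code m (4 * m + 2) - wshift m (4 * m + 2) = (4 * int m + 2) * (int m + 1)"
  proof -
    have "(int (4 * m + 2) - 1) div 2 = 2 * int m" "(int (4 * m + 2) - 1) mod 2 = 1"
      by simp_all presburger+
    then show ?thesis unfolding code_def wshift_def by (simp add: algebra_simps)
  qed
  moreover have "U 1 - V 1 = 0" by (simp add: U_def V_def code_def wshift_def)
  ultimately have eq: "[code m (4 * m + 2) - wshift m (4 * m + 2) = U 1 - V 1] (mod (4 * int m + 2))"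
    by (simp add: cong_iff_dvd_diff)
  have M: "M (a, b) (c, d) =
      of_bool (c = decode m (code m b + U a) \<and> d = decode m (code m b + V a)) +
      of_bool (a = 4 * m + 2 \<and> c = decode m (code m b + code m (4 * m + 2)) \<and>
        d = decode m (code m b + wshift m (4 * m + 2)))"
    if "a \<in> {1..4 * m + 2}" "b \<in> {1..4 * m + 2}" for a b c d
    unfolding M_def prod.case lookup_nbly_poly[OF that]
    by (cases "a = 4 * m + 2") (simp_all add: U_def V_def add.commute)
  from translation_matrix_independent[OF inj 1 eq M]
  show "rows_independent I I M" "rows_independent I I (\<lambda>c r. M r c)"
    unfolding I_def by blast+
qed

text \<open>The relevant difference is \<open>- wshift m a\<close>, which is injective. The extra
  term has difference 0, matched by \<open>a0 = 1\<close>.\<close>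

lemma rows_independent_xz_yw:
  fixes m :: nat
  defines "M \<equiv> \<lambda>(a, c) (b, d). Poly_Mapping.lookup (nbly_poly m :: 'a::field polynomial) (mono4 a b c d)"
    and "I \<equiv> {1..4 * m + 2} \<times> {1..4 * m + 2}"
  shows "rows_independent I I M" "rows_independent I I (\<lambda>c r. M r c)"
proof -
  let ?U = "\<lambda>a. - code m a" and ?V = "\<lambda>a. wshift m a - code m a"
  have inj: "a = b" if "a \<in> {1..4 * m + 2}" "b \<in> {1..4 * m + 2}"
    "[?U a - ?V a = ?U b - ?V b] (mod (4 * int m + 2))" for a b
    using inj_wshift[OF that(1,2)] that(3) by (simp add: cong_minus_minus_iff)
  have 1: "1 \<in> {1..<4 * m + 2}" by simp
  \<comment> \<open>The unsimplified differences are the shapes \<open>- s\<close> and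
    \<open>t - s\<close> of \<open>cong_pair_solve\<close>, with \<open>s = 2 * m + 1\<close> and
    \<open>t = 0\<close>.\<close>
  have eq: "[- (2 * int m + 1) - (0 - (2 * int m + 1)) = ?U 1 - ?V 1] (mod (4 * int m + 2))"
    by (simp add: wshift_def)
  have M: "M (a, c) (b, d) =
      of_bool (b = decode m (code m c + ?U a) \<and> d = decode m (code m c + ?V a)) +
      of_bool (a = 4 * m + 2 \<and> b = decode m (code m c + - (2 * int m + 1)) \<and>
        d = decode m (code m c + (0 - (2 * int m + 1))))"
    if "a \<in> {1..4 * m + 2}" "c \<in> {1..4 * m + 2}" "b \<in> {1..4 * m + 2}" "d \<in> {1..4 * m + 2}"
    for a b c d
    unfolding M_def prod.case lookup_nbly_poly_cong[OF that(1,3,2,4)]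
      eq_decode_iff[OF that(3)] eq_decode_iff[OF that(4)] cong_pair_solve by simp
  from translation_matrix_independent[OF inj 1 eq M]
  show "rows_independent I I M" "rows_independent I I (\<lambda>c r. M r c)"
    unfolding I_def by blast+
qed

text \<open>The relevant difference is \<open>- code m a\<close>, which is injective. The extra term
  has difference \<open>- (2 * m + 1)\<close>, attained at the overlined index 1, that is
  \<open>a0 = 2 * m + 2\<close>; it differs from the last index because
  \<open>m > 0\<close>.\<close>

lemma rows_independent_xw_yz:
  assumes "m > 0"
  defines "M \<equiv> \<lambda>(a, d) (b, c). Poly_Mapping.lookup (nbly_poly m :: 'a::field polynomial) (mono4 a b c d)"
    and "I \<equiv> {1..4 * m + 2} \<times> {1..4 * m + 2}"
  shows "rows_independent I I M" "rows_independent I I (\<lambda>c r. M r c)"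
proof -
  let ?U = "\<lambda>a. - wshift m a" and ?V = "\<lambda>a. code m a - wshift m a"
  have inj: "a = b" if "a \<in> {1..4 * m + 2}" "b \<in> {1..4 * m + 2}"
    "[?U a - ?V a = ?U b - ?V b] (mod (4 * int m + 2))" for a b
    using inj_code[OF that(1,2)] that(3) by (simp add: cong_minus_minus_iff)
  have a0: "2 * m + 2 \<in> {1..<4 * m + 2}" using \<open>m > 0\<close> by simp
  have "- 0 - (2 * int m + 1 - 0) - (?U (2 * m + 2) - ?V (2 * m + 2)) = (4 * int m + 2) * (int m + 1)"
    by (simp add: code_def algebra_simps)
  then have eq: "[- 0 - (2 * int m + 1 - 0) = ?U (2 * m + 2) - ?V (2 * m + 2)] (mod (4 * int m + 2))"
    unfolding cong_iff_dvd_diff by (metis dvd_triv_left)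
  have M: "M (a, d) (b, c) =
      of_bool (b = decode m (code m d + ?U a) \<and> c = decode m (code m d + ?V a)) +
      of_bool (a = 4 * m + 2 \<and> b = decode m (code m d + - 0) \<and>
        c = decode m (code m d + (2 * int m + 1 - 0)))"
    if "a \<in> {1..4 * m + 2}" "d \<in> {1..4 * m + 2}" "b \<in> {1..4 * m + 2}" "c \<in> {1..4 * m + 2}"
    for a b c d
    unfolding M_def prod.case lookup_nbly_poly_cong[OF that(1,3,4,2)]
      eq_decode_iff[OF that(3)] eq_decode_iff[OF that(4)] cong_pair_solve
    by (intro arg_cong2[of _ _ _ _ "(+)"] arg_cong[of _ _ of_bool]) auto
  from translation_matrix_independent[OF inj a0 eq M]
  show "rows_independent I I M" "rows_independent I I (\<lambda>c r. M r c)"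
    unfolding I_def by blast+
qed

text \<open>Each splitting settles both of its pairs, one through the rows and the other through the
  columns of its matrix; three splittings cover all six pairs.\<close>

lemma derivs_independent_nbly_poly:
  assumes "m > 0" "p \<in> {1, 2, 3, 4}" "q \<in> {1, 2, 3, 4}" "p < q"
  shows "derivs_independent (4 * m + 2) (nbly_poly m) {p, q}"
proof -
  have mono: "var_monom (X a) + var_monom (Y b) + (var_monom (Z c) + var_monom (W d)) = mono4 a b c d"
    "var_monom (Z c) + var_monom (W d) + (var_monom (X a) + var_monom (Y b)) = mono4 a b c d"
    "var_monom (X a) + var_monom (Z c) + (var_monom (Y b) + var_monom (W d)) = mono4 a b c d"
    "var_monom (Y b) + var_monom (W d) + (var_monom (X a) + var_monom (Z c)) = mono4 a b c d"
    "var_monom (X a) + var_monom (W d) + (var_monom (Y b) + var_monom (Z c)) = mono4 a b c d"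
    "var_monom (Y b) + var_monom (Z c) + (var_monom (X a) + var_monom (W d)) = mono4 a b c d" for a b c d
    by (simp_all only: mono4_def add.assoc add.commute add.left_commute)
  have var: "var_of 1 = X" "var_of 2 = Y" "var_of 3 = Z" "var_of 4 = W"
    by (simp_all add: var_of_def)
  note pair = derivs_independent_pair[where f = "nbly_poly m" and k = "4 * m + 2"]
  note xy = rows_independent_xy_zw[of m] and xz = rows_independent_xz_yw[of m]
    and xw = rows_independent_xw_yz[OF \<open>m > 0\<close>]
  have "derivs_independent (4 * m + 2) (nbly_poly m) {1, 2}"
    by (rule pair[of _ _ 3 4]) (simp_all only: var mono xy, simp_all)
  moreover have "derivs_independent (4 * m + 2) (nbly_poly m) {3, 4}"
    by (rule pair[of _ _ 1 2]) (use xy(2) in \<open>simp_all only: var mono case_prod_unfold\<close>, simp_all)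
  moreover have "derivs_independent (4 * m + 2) (nbly_poly m) {1, 3}"
    by (rule pair[of _ _ 2 4]) (simp_all only: var mono xz, simp_all)
  moreover have "derivs_independent (4 * m + 2) (nbly_poly m) {2, 4}"
    by (rule pair[of _ _ 1 3]) (use xz(2) in \<open>simp_all only: var mono case_prod_unfold\<close>, simp_all)
  moreover have "derivs_independent (4 * m + 2) (nbly_poly m) {1, 4}"
    by (rule pair[of _ _ 2 3]) (simp_all only: var mono xw, simp_all)
  moreover have "derivs_independent (4 * m + 2) (nbly_poly m) {2, 3}"
    by (rule pair[of _ _ 1 4]) (use xw(2) in \<open>simp_all only: var mono case_prod_unfold\<close>, simp_all)
  ultimately show ?thesis using assms(2-4) by auto
qed

theorem theorem3p4:
  fixes m k :: nat and f :: "'a::field polynomial"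
  assumes "m > 0"
    and "k = 4 * m + 2"
    and "f = nbly_poly m"
  shows "balanced_neighborly k f"
  unfolding balanced_neighborly_def
proof (intro conjI allI impI)
  have "{mono4 a b c d | a b c d. {a, b, c, d} \<subseteq> {1..k}} \<subseteq> monoms k {1, 2, 3, 4}"
    unfolding insert_subset by (clarify, rule mono4_in_monoms)
  then have "Poly_Mapping.keys f \<subseteq> monoms k {1, 2, 3, 4}"
    unfolding assms(2,3) by (rule order_trans[OF keys_nbly_poly])
  moreover have "set_deg {1, 2, 3, 4} = (\<lambda>j. if j \<in> {1, 2, 3, 4} then 1 else 0)"
    by (rule ext) (simp add: set_deg_eq)
  ultimately show "balanced k f"
    by (auto simp: balanced_def graded_component_def ring_R_def monoms_def)
next
  fix S :: "nat set" assume S: "S \<subseteq> {1, 2, 3, 4} \<and> card S \<le> 2"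
  \<comment> \<open>Enlarging \<open>S\<close> to a pair reduces every degree to the six pairs
    already treated.\<close>
  have "\<exists>p q. p \<in> {1, 2, 3, 4} \<and> q \<in> {1, 2, 3, 4} \<and> p < q \<and> S \<subseteq> {p, q}"
  proof -
    have "finite S" using S finite_subset by blast
    consider "card S = 0" | "card S = 1" | "card S = 2" using S by linarith
    then show ?thesis
    proof cases
      case 1
      with \<open>finite S\<close> have "S \<subseteq> {1, 2}" by simp
      then show ?thesis by (intro exI[of _ "1::nat"] exI[of _ "2::nat"]) auto
    next
      case 2
      then obtain x where "S = {x}" by (auto simp: card_1_singleton_iff)
      with S have x: "x \<in> {1, 2, 3, 4}" "S = {x}" by auto
      then show ?thesis
        by (intro exI[of _ "1::nat"] exI[of _ "if x = 1 then 2 else x"]) auto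
    next
      case 3
      then obtain x y where "S = {x, y}" "x \<noteq> y" by (auto simp: card_2_iff)
      moreover from this S have "x \<in> {1, 2, 3, 4}" "y \<in> {1, 2, 3, 4}" by auto
      ultimately show ?thesis
        by (intro exI[of _ "min x y"] exI[of _ "max x y"]) (auto simp: min_def max_def)
    qed
  qed
  then obtain p q where pq: "p \<in> {1, 2, 3, 4}" "q \<in> {1, 2, 3, 4}" "p < q" "S \<subseteq> {p, q}"
    by blast
  have "derivs_independent k f S"
    by (rule derivs_independent_subset[of k f "{p, q}"])
       (use derivs_independent_nbly_poly[OF assms(1) pq(1-3)] pq assms in simp_all)
  moreover have "multilinear f" unfolding assms(3) by (rule multilinear_nbly_poly)
  ultimately show "H k f S = k ^ card S" using S H_eq_power by blast
qed

end
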